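(* Let $k\ge 1$ and $n\ge1$ be integers. If $f\in T_{n-1}^\perp$, then for any real $\alpha>1$ $$\|f\|\le c_\alpha\,\gamma_{2k}^*\,\omega_{2k}\left(f,\frac{\alpha\pi}{n}\right),\qquad c_\alpha=\left(\cos\frac{\pi}{2\alpha}\right)^{-1}.$$
   Context: All functions are continuous and $2\pi$-periodic on $\mathbb{R}$, $\|\cdot\|$ is the uniform norm, and $T_{n-1}^\perp$ is the set of such $f$ with $\int_{-\pi}^{\pi}f(x)\tau(x)\,dx=0$ for all trigonometric polynomials $\tau$ of degree $\le n-1$. The modulus of smoothness is $\omega_{r}(f,\delta)=\sup_{0<t\le\delta}\|\Delta_t^r(f,\cdot)\|$, where $\Delta_t^r(f,x)=\sum_{i=0}^r(-1)^i\binom{r}{i}f(x+it)$. $\gamma_{2k}^*=\binom{2k}{k}^{-1}$. *)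

theory Defs
  imports "HOL-Analysis.Analysis"
begin

definition periodic_cont :: "(real \<Rightarrow> real) set" where
  "periodic_cont = {f. continuous_on UNIV f \<and> (\<forall>x. f (x + 2 * pi) = f x)}"

(* The supremum is the genuine one only for bounded f; members of periodic_cont are bounded. *)
definition unif_norm :: "(real \<Rightarrow> real) \<Rightarrow> real" where
  "unif_norm f = (SUP x. \<bar>f x\<bar>)"

definition trig_poly :: "nat \<Rightarrow> (real \<Rightarrow> real) set" where
  "trig_poly m =
     {\<tau>. \<exists>a b :: nat \<Rightarrow> real.
        \<forall>x. \<tau> x = (\<Sum>j\<le>m. a j * cos (real j * x) + b j * sin (real j * x))}"

definition trig_perp :: "nat \<Rightarrow> (real \<Rightarrow> real) set" where
  "trig_perp m =
     {f \<in> periodic_cont. \<forall>\<tau> \<in> trig_poly m. integral {-pi..pi} (\<lambda>x. f x * \<tau> x) = 0}"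

(* The sign is (-1)^i, not (-1)^(r-i), so for odd r this is the negative of the usual forward
   difference. *)
definition fin_diff :: "nat \<Rightarrow> real \<Rightarrow> (real \<Rightarrow> real) \<Rightarrow> real \<Rightarrow> real" where
  "fin_diff r t f x = (\<Sum>i\<le>r. (-1) ^ i * real (r choose i) * f (x + real i * t))"

(* For f in periodic_cont the norms are bounded by 2^r * unif_norm f, so for \<delta> > 0 the supremum
   is the genuine one. *)
definition mod_smooth :: "nat \<Rightarrow> (real \<Rightarrow> real) \<Rightarrow> real \<Rightarrow> real" where
  "mod_smooth r f \<delta> = (SUP t\<in>{0<..\<delta>}. unif_norm (fin_diff r t f))"

(* gamma_star k is the constant written \<gamma>*_{2k} in the literature. *)
definition gamma_star :: "nat \<Rightarrow> real" where
  "gamma_star k = inverse (real ((2 * k) choose k))"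

definition c_const :: "real \<Rightarrow> real" where
  "c_const \<alpha> = inverse (cos (pi / (2 * \<alpha>)))"

end

theory Submission imports Defs
begin

text \<open>
  Let \<open>h = \<alpha> \<pi> / n\<close> and \<open>\<mu> = \<pi> / h = n / \<alpha> < n\<close>. The function \<open>f\<close> has mean zero, so it
  has a periodic second antiderivative \<open>F\<close>, which may be chosen orthogonal to the same trigonometric
  polynomials as \<open>f\<close>. The centered difference of order \<open>2k\<close>, divided by its central coefficient, is
  \<open>f(x) + (\<Sum>i=1..k. (-1)^i a_i (f(x+it) + f(x-it)))\<close> with
  \<open>a_i = (2k choose k+i) / (2k choose k) \<in> [0,1]\<close>. Averaging it over \<open>t\<close> with the hat kernel
  \<open>2(h-t)/h^2\<close> on \<open>[0,h]\<close> gives a function bounded by \<open>W = \<gamma>*_{2k} \<omega>_{2k}(f,h)\<close>, and each average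
  of \<open>f(x+it) + f(x-it)\<close> becomes a second difference of \<open>F\<close>. Thus

  \<open>|f + A F| \<le> W\<close>, where
  \<open>A F(x) = 2/h^2 (\<Sum>i=1..k. (-1)^i a_i/i^2 (F(x+ih) + F(x-ih) - 2 F(x)))\<close>

  is a finite combination of translations of \<open>F\<close>. The sum of the absolute values of its
  coefficients is \<open>4/h^2\<close> times
  \<open>(\<Sum>i=1..k. a_i/i^2) + |\<Sum>i=1..k. (-1)^i a_i/i^2| \<le> \<pi>^2/4\<close>, hence at most \<open>\<mu>^2\<close>
  (\<open>alternating_inverse_squares_bound\<close>).

  What remains does not involve differences any more: if \<open>F'' = f\<close>, both are orthogonal to the
  trigonometric polynomials of degree less than \<open>n\<close>, and \<open>|f + A F| \<le> W\<close> for a combination \<open>A\<close> of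
  translations of total mass at most \<open>\<mu>^2\<close>, then \<open>|f| \<le> W / cos(\<mu> \<pi> / 2n)\<close>
  (\<open>norm_bound_of_perturbed_identity\<close>). For this pass to harmonic extensions. Let \<open>v(x,s)\<close> be the
  Poisson integral of \<open>F\<close>, with radius \<open>e^{-s}\<close>. Harmonicity gives \<open>v_ss = -P_s f = A v - P_s (f + A F)\<close>.
  The key fact is that modulo trigonometric polynomials of degree less than \<open>n\<close> the Poisson kernel
  equals \<open>cos(ny) P_s(y) / cosh(ns)\<close>, which has the sign of \<open>cos(ny)\<close>
  (\<open>poisson_mod_trig_poly\<close>). So with \<open>N(s)\<close> the \<open>L_1\<close> norm of that kernel,
  \<open>|v_ss| \<le> W N(s) + \<mu>^2 sup_x |v(x,s)|\<close>, and equality would hold in the estimate \<open>|P_s g| \<le> N(s) |g|\<close>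
  for \<open>g = sgn (cos(nx))\<close>. This suggests the comparison function \<open>Z\<close> that solves
  \<open>Z'' + \<mu>^2 Z = - sgn (cos(nx))\<close> and changes sign under translation by \<open>\<pi>/n\<close>: near \<open>0\<close> it is
  \<open>(cos(\<mu>x) / cos(\<mu>\<pi>/2n) - 1) / \<mu>^2\<close>. Its Poisson integral \<open>y(s)\<close> at the origin satisfies
  \<open>y'' = \<mu>^2 y + N\<close> exactly. Since all these functions vanish exponentially at infinity, convexity
  yields \<open>|v(x,s)| \<le> W y(s)\<close>, and \<open>s \<rightarrow> 0\<close> gives \<open>|F| \<le> W Z(0)\<close>. Finally
  \<open>|f| \<le> W + \<mu>^2 |F| \<le> W (1 + \<mu>^2 Z(0)) = W / cos(\<mu>\<pi>/2n) = W c_\<alpha>\<close>.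
\<close>

section \<open>Periodic functions and orthogonality to trigonometric polynomials\<close>

lemma continuous_on_trig_poly:
  assumes "\<tau> \<in> trig_poly m"
  shows "continuous_on S \<tau>"
proof -
  obtain a b where *: "\<And>x. \<tau> x = (\<Sum>j\<le>m. a j * cos (real j * x) + b j * sin (real j * x))"
    using assms by (auto simp: trig_poly_def)
  have "continuous_on S (\<lambda>x. \<Sum>j\<le>m. a j * cos (real j * x) + b j * sin (real j * x))"
    by (intro continuous_intros)
  then show ?thesis
    by (simp add: *[abs_def])
qed

lemma cos_in_trig_poly: "j \<le> m \<Longrightarrow> (\<lambda>x. cos (real j * x)) \<in> trig_poly m"
  unfolding trig_poly_def
  by (intro CollectI exI[of _ "\<lambda>i. if i = j then 1 else 0"] exI[of _ "\<lambda>i. 0"])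
    (simp add: if_distrib[of "\<lambda>c. c * _"] cong: if_cong)

lemma sin_in_trig_poly: "j \<le> m \<Longrightarrow> (\<lambda>x. sin (real j * x)) \<in> trig_poly m"
  unfolding trig_poly_def
  by (intro CollectI exI[of _ "\<lambda>i. 0"] exI[of _ "\<lambda>i. if i = j then 1 else 0"])
    (simp add: if_distrib[of "\<lambda>c. c * _"] cong: if_cong)

lemma trig_poly_lincomb:
  assumes "\<sigma> \<in> trig_poly m" "\<tau> \<in> trig_poly m"
  shows "(\<lambda>x. c * \<sigma> x + d * \<tau> x) \<in> trig_poly m"
proof -
  obtain a b a' b' where
    "\<And>x. \<sigma> x = (\<Sum>j\<le>m. a j * cos (real j * x) + b j * sin (real j * x))"
    "\<And>x. \<tau> x = (\<Sum>j\<le>m. a' j * cos (real j * x) + b' j * sin (real j * x))"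
    using assms by (auto simp: trig_poly_def)
  then show ?thesis
    unfolding trig_poly_def
    by (intro CollectI exI[of _ "\<lambda>j. c * a j + d * a' j"] exI[of _ "\<lambda>j. c * b j + d * b' j"])
      (simp add: sum_distrib_left sum.distrib[symmetric] algebra_simps)
qed

lemma trig_poly_mono:
  assumes "\<tau> \<in> trig_poly m" "m \<le> m'"
  shows "\<tau> \<in> trig_poly m'"
proof -
  obtain a b where *: "\<And>x. \<tau> x = (\<Sum>j\<le>m. a j * cos (real j * x) + b j * sin (real j * x))"
    using assms by (auto simp: trig_poly_def)
  have "\<tau> x = (\<Sum>j\<le>m'. (if j \<le> m then a j else 0) * cos (real j * x)
                      + (if j \<le> m then b j else 0) * sin (real j * x))" for x
    unfolding * using \<open>m \<le> m'\<close> by (intro sum.mono_neutral_cong_left) auto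
  then show ?thesis
    unfolding trig_poly_def by (intro CollectI exI allI)
qed

lemma periodic_contD:
  assumes "f \<in> periodic_cont"
  shows "continuous_on S f" "f (x + 2 * pi) = f x" "f pi = f (- pi)"
proof -
  show "continuous_on S f"
    using assms continuous_on_subset unfolding periodic_cont_def by blast
  show per: "f (x + 2 * pi) = f x" for x
    using assms by (simp add: periodic_cont_def)
  show "f pi = f (- pi)"
    using per[of "- pi"] by simp
qed

lemma periodic_cont_int_period:
  assumes "f \<in> periodic_cont"
  shows "f (x + 2 * pi * of_int i) = f x"
proof -
  have per: "f (x + 2 * pi * real i) = f x" for i x
    using periodic_contD(2)[OF assms, of "x + 2 * pi * real i" for i]
    by (induction i) (simp_all add: algebra_simps)
  show ?thesis
    using per[of x "nat i"] per[of "x + 2 * pi * of_int i" "nat (- i)"]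
    by (cases "i \<ge> 0") auto
qed

text \<open>
  A bound on one period suffices, since every point is congruent to one of that period.
\<close>
lemma periodic_cont_bounded:
  assumes "f \<in> periodic_cont"
  obtains M where "0 \<le> M" "\<And>x. \<bar>f x\<bar> \<le> M"
proof -
  have "compact (f ` {-pi..pi})"
    by (intro compact_continuous_image periodic_contD[OF assms] compact_Icc)
  then obtain M where M: "\<And>x. x \<in> {-pi..pi} \<Longrightarrow> \<bar>f x\<bar> \<le> M"
    by (metis bounded_iff compact_imp_bounded imageI real_norm_def)
  note per = periodic_cont_int_period[OF assms]
  have "\<bar>f x\<bar> \<le> M" for x
  proof -
    define i where "i = \<lfloor>(x + pi) / (2 * pi)\<rfloor>"
    have "of_int i \<le> (x + pi) / (2 * pi)" "(x + pi) / (2 * pi) < of_int i + 1"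
      unfolding i_def by linarith+
    then have "x + 2 * pi * of_int (- i) \<in> {-pi..pi}"
      by (simp add: field_simps)
    then show ?thesis
      using M per by metis
  qed
  moreover from this[of 0] have "0 \<le> M" by linarith
  ultimately show ?thesis using that by blast
qed

lemma periodic_cont_shift: "f \<in> periodic_cont \<Longrightarrow> (\<lambda>y. f (x + y)) \<in> periodic_cont"
  unfolding periodic_cont_def
  by (auto intro!: continuous_intros continuous_on_compose2[of UNIV f] simp: add.assoc[symmetric])

lemma periodic_cont_lincomb:
  "f \<in> periodic_cont \<Longrightarrow> g \<in> periodic_cont \<Longrightarrow> (\<lambda>x. c * f x + d * g x) \<in> periodic_cont"
  unfolding periodic_cont_def by (auto intro!: continuous_intros)

lemma periodic_cont_mult:
  "f \<in> periodic_cont \<Longrightarrow> g \<in> periodic_cont \<Longrightarrow> (\<lambda>x. f x * g x) \<in> periodic_cont"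
  unfolding periodic_cont_def by (auto intro!: continuous_intros)

lemma sincos_mult_period:
  "cos (real j * (x + 2 * pi)) = cos (real j * x)" "sin (real j * (x + 2 * pi)) = sin (real j * x)"
  using sin_int_2pin[of "int j"] cos_int_2pin[of "int j"]
  by (auto simp: distrib_left cos_add sin_add mult_ac)

lemma trig_poly_periodic_cont:
  assumes "\<tau> \<in> trig_poly m"
  shows "\<tau> \<in> periodic_cont"
proof -
  obtain a b where *: "\<And>x. \<tau> x = (\<Sum>j\<le>m. a j * cos (real j * x) + b j * sin (real j * x))"
    using assms by (auto simp: trig_poly_def)
  show ?thesis
    using continuous_on_trig_poly[OF assms] unfolding periodic_cont_def
    by (simp only: * sincos_mult_period mem_Collect_eq simp_thms)
qed

text \<open>
  For a shift within one period, the part of the window that leaves \<open>[-\<pi>,\<pi>]\<close> is moved back by a full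
  period; an arbitrary shift is congruent to such a one.
\<close>
lemma integral_periodic_shift:
  assumes "f \<in> periodic_cont"
  shows "integral {-pi..pi} (\<lambda>y. f (x + y)) = integral {-pi..pi} f"
proof -
  have pos: "integral {-pi..pi} (\<lambda>y. g (x + y)) = integral {-pi..pi} g"
    if "0 \<le> x" "x \<le> 2 * pi" and g: "g \<in> periodic_cont" for x :: real and g
  proof -
    note cont = periodic_contD(1)[OF g]
    have int: "g integrable_on {a..b}" for a b
      by (intro integrable_continuous_real cont)
    have "integral {-pi..pi} (\<lambda>y. g (x + y)) = integral {x - pi..x + pi} g"
      using integral_shift_real_ivl[of "x - pi" x "x + pi" g] by (simp add: add.commute)
    also have "\<dots> = integral {x - pi..pi} g + integral {pi..x + pi} g"
      using that by (intro Henstock_Kurzweil_Integration.integral_combine[symmetric] int) auto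
    also have "integral {pi..x + pi} g = integral {-pi..x - pi} g"
    proof -
      have "integral {-pi..x - pi} (\<lambda>y. g (y + 2 * pi)) = integral {pi..x + pi} g"
        using integral_shift_real_ivl[of pi "2 * pi" "x + pi" g] by simp
      then show ?thesis
        by (simp add: periodic_contD(2)[OF g])
    qed
    also have "integral {x - pi..pi} g + integral {-pi..x - pi} g = integral {-pi..pi} g"
      using that 
        Henstock_Kurzweil_Integration.integral_combine[of "-pi" "x - pi" pi g, OF _ _ int]
      by simp
    finally show ?thesis .
  qed
  note per = periodic_cont_int_period[OF assms]
  define i where "i = \<lfloor>x / (2 * pi)\<rfloor>"
  have "of_int i \<le> x / (2 * pi)" "x / (2 * pi) < of_int i + 1"
    unfolding i_def by linarith+
  then have "0 \<le> x + 2 * pi * of_int (- i)" "x + 2 * pi * of_int (- i) \<le> 2 * pi"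
    by (simp_all add: field_simps)
  then have "integral {-pi..pi} (\<lambda>y. f (x + 2 * pi * of_int (- i) + y)) = integral {-pi..pi} f"
    using assms by (intro pos) auto
  moreover have "f (x + 2 * pi * of_int (- i) + y) = f (x + y)" for y
    using per[of "x + y" "-i"] by (simp add: algebra_simps)
  ultimately show ?thesis by simp
qed

lemma trig_perp_iff:
  "f \<in> trig_perp m \<longleftrightarrow> f \<in> periodic_cont \<and>
     (\<forall>j\<le>m. integral {-pi..pi} (\<lambda>x. f x * cos (real j * x)) = 0 \<and>
            integral {-pi..pi} (\<lambda>x. f x * sin (real j * x)) = 0)"
  (is "_ \<longleftrightarrow> _ \<and> ?Q")
proof safe
  assume "f \<in> trig_perp m"
  then show "f \<in> periodic_cont"
    and "j \<le> m \<Longrightarrow> integral {-pi..pi} (\<lambda>x. f x * cos (real j * x)) = 0"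
    and "j \<le> m \<Longrightarrow> integral {-pi..pi} (\<lambda>x. f x * sin (real j * x)) = 0" for j
    using cos_in_trig_poly[of j m] sin_in_trig_poly[of j m] unfolding trig_perp_def by auto
next
  assume f: "f \<in> periodic_cont" and Q: ?Q
  note [continuous_intros] = periodic_contD(1)[OF f]
  have "integral {-pi..pi} (\<lambda>x. f x * \<tau> x) = 0" if \<tau>: "\<tau> \<in> trig_poly m" for \<tau>
  proof -
    obtain a b where *: "\<And>x. \<tau> x = (\<Sum>j\<le>m. a j * cos (real j * x) + b j * sin (real j * x))"
      using \<tau> by (auto simp: trig_poly_def)
    have "integral {-pi..pi} (\<lambda>x. f x * \<tau> x) = integral {-pi..pi}
        (\<lambda>x. \<Sum>j\<le>m. a j * (f x * cos (real j * x)) + b j * (f x * sin (real j * x)))"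
      unfolding * by (simp add: sum_distrib_left algebra_simps)
    also have "\<dots> = (\<Sum>j\<le>m. integral {-pi..pi}
        (\<lambda>x. a j * (f x * cos (real j * x)) + b j * (f x * sin (real j * x))))"
      by (intro integral_sum integrable_continuous_real continuous_intros) auto
    also have "\<dots> = 0"
    proof (rule sum.neutral, rule ballI)
      fix j assume "j \<in> {..m}"
      moreover have "integral {-pi..pi}
          (\<lambda>x. a j * (f x * cos (real j * x)) + b j * (f x * sin (real j * x))) =
        integral {-pi..pi} (\<lambda>x. a j * (f x * cos (real j * x))) +
        integral {-pi..pi} (\<lambda>x. b j * (f x * sin (real j * x)))"
        by (intro Henstock_Kurzweil_Integration.integral_add integrable_continuous_real
            continuous_intros)
      ultimately show "integral {-pi..pi}
          (\<lambda>x. a j * (f x * cos (real j * x)) + b j * (f x * sin (real j * x))) = 0"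
        using Q by simp
    qed
    finally show ?thesis .
  qed
  then show "f \<in> trig_perp m"
    using f by (simp add: trig_perp_def)
qed

lemma trig_perp_lincomb:
  assumes f: "f \<in> trig_perp m" and g: "g \<in> trig_perp m"
  shows "(\<lambda>x. c * f x + d * g x) \<in> trig_perp m"
proof -
  have [continuous_intros]: "continuous_on S f" "continuous_on S g" for S
    using f g by (auto simp: trig_perp_def intro: periodic_contD)
  have "integral {-pi..pi} (\<lambda>x. (c * f x + d * g x) * \<tau> x) = 0" if "\<tau> \<in> trig_poly m" for \<tau>
  proof -
    note [continuous_intros] = continuous_on_trig_poly[OF that]
    have "integral {-pi..pi} (\<lambda>x. (c * f x + d * g x) * \<tau> x) =
      integral {-pi..pi} (\<lambda>x. c * (f x * \<tau> x) + d * (g x * \<tau> x))"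
      by (simp add: algebra_simps)
    also have "\<dots> = integral {-pi..pi} (\<lambda>x. c * (f x * \<tau> x)) +
      integral {-pi..pi} (\<lambda>x. d * (g x * \<tau> x))"
      by (intro Henstock_Kurzweil_Integration.integral_add integrable_continuous_real
          continuous_intros)
    finally show ?thesis
      using f g that by (simp add: trig_perp_def)
  qed
  then show ?thesis
    using f g by (auto simp: trig_perp_def intro: periodic_cont_lincomb)
qed

lemma zero_in_trig_perp: "(\<lambda>x. 0) \<in> trig_perp m"
  by (simp add: trig_perp_def periodic_cont_def)

lemma trig_perp_sum:
  assumes "finite I" "\<And>i. i \<in> I \<Longrightarrow> f i \<in> trig_perp m"
  shows "(\<lambda>x. \<Sum>i\<in>I. f i x) \<in> trig_perp m"
  using assms
proof (induction I rule: finite_induct)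
  case (insert i I)
  then show ?case
    using trig_perp_lincomb[of "f i" m "\<lambda>x. \<Sum>i\<in>I. f i x" 1 1] by simp
qed (simp add: zero_in_trig_perp)

text \<open>
  A translation rotates the pair of Fourier coefficients of each frequency. This is what makes
  orthogonality translation invariant and lets antiperiodicity kill the low frequencies.
\<close>
lemma integral_mult_sincos_shift:
  fixes f :: "real \<Rightarrow> real" and j :: nat and x :: real
  assumes f: "f \<in> periodic_cont"
  defines "C \<equiv> integral {-pi..pi} (\<lambda>y. f y * cos (real j * y))"
    and "S \<equiv> integral {-pi..pi} (\<lambda>y. f y * sin (real j * y))"
  shows "integral {-pi..pi} (\<lambda>y. f (x + y) * cos (real j * y)) =
           cos (real j * x) * C + sin (real j * x) * S"
    and "integral {-pi..pi} (\<lambda>y. f (x + y) * sin (real j * y)) =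
           cos (real j * x) * S - sin (real j * x) * C"
proof -
  note [continuous_intros] = periodic_contD(1)[OF f]
  have cos_p: "(\<lambda>y. f y * cos (real j * y)) \<in> periodic_cont"
    by (rule periodic_cont_mult[OF f trig_poly_periodic_cont[OF cos_in_trig_poly[OF order_refl]]])
  have sin_p: "(\<lambda>y. f y * sin (real j * y)) \<in> periodic_cont"
    by (rule periodic_cont_mult[OF f trig_poly_periodic_cont[OF sin_in_trig_poly[OF order_refl]]])
  have *: "integral {-pi..pi} (\<lambda>y. a * (f (x + y) * cos (real j * (x + y)))
         + b * (f (x + y) * sin (real j * (x + y)))) = a * C + b * S" for a b
  proof -
    have "integral {-pi..pi} (\<lambda>y. a * (f (x + y) * cos (real j * (x + y)))
         + b * (f (x + y) * sin (real j * (x + y)))) =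
       integral {-pi..pi} (\<lambda>y. a * (f y * cos (real j * y)) + b * (f y * sin (real j * y)))"
      by (rule integral_periodic_shift[OF periodic_cont_lincomb[OF cos_p sin_p]])
    also have "\<dots> = integral {-pi..pi} (\<lambda>y. a * (f y * cos (real j * y)))
       + integral {-pi..pi} (\<lambda>y. b * (f y * sin (real j * y)))"
      by (intro Henstock_Kurzweil_Integration.integral_add integrable_continuous_real
          continuous_intros)
    finally show ?thesis by (simp add: C_def S_def)
  qed
  have c: "cos (real j * y) = cos (real j * x) * cos (real j * (x + y))
      + sin (real j * x) * sin (real j * (x + y))" for y
    using cos_diff[of "real j * x" "real j * (x + y)"] by (simp add: algebra_simps)
  have "f (x + y) * cos (real j * y) =
      cos (real j * x) * (f (x + y) * cos (real j * (x + y)))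
      + sin (real j * x) * (f (x + y) * sin (real j * (x + y)))" for y
    using c[of y] by algebra
  then show "integral {-pi..pi} (\<lambda>y. f (x + y) * cos (real j * y)) =
           cos (real j * x) * C + sin (real j * x) * S"
    using *[of "cos (real j * x)" "sin (real j * x)"] by simp
  have c': "sin (real j * y) = - sin (real j * x) * cos (real j * (x + y))
      + cos (real j * x) * sin (real j * (x + y))" for y
    using sin_diff[of "real j * (x + y)" "real j * x"] by (simp add: algebra_simps)
  have "f (x + y) * sin (real j * y) =
      - sin (real j * x) * (f (x + y) * cos (real j * (x + y)))
      + cos (real j * x) * (f (x + y) * sin (real j * (x + y)))" for y
    using c'[of y] by algebra
  then show "integral {-pi..pi} (\<lambda>y. f (x + y) * sin (real j * y)) =
           cos (real j * x) * S - sin (real j * x) * C"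
    using *[of "- sin (real j * x)" "cos (real j * x)"] by simp
qed

lemma trig_perp_shift:
  assumes "f \<in> trig_perp m"
  shows "(\<lambda>y. f (x + y)) \<in> trig_perp m"
  using assms integral_mult_sincos_shift[of f] periodic_cont_shift[of f x]
  unfolding trig_perp_iff by simp

text \<open>
  At frequency \<open>j\<close>, translation by \<open>\<pi>/n\<close> rotates the pair of Fourier coefficients by the angle
  \<open>j \<pi>/n\<close>, which lies in \<open>[0,\<pi>)\<close> for \<open>j < n\<close>. Antiperiodicity asks that this rotation negate the
  pair, and only the rotation by \<open>\<pi>\<close> negates a nonzero vector.
\<close>
lemma antiperiodic_in_trig_perp:
  assumes f: "f \<in> periodic_cont" and n: "n \<ge> 1" and anti: "\<And>x. f (pi / real n + x) = - f x"
  shows "f \<in> trig_perp (n - 1)"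
proof -
  have "integral {-pi..pi} (\<lambda>y. f y * cos (real j * y)) = 0 \<and>
        integral {-pi..pi} (\<lambda>y. f y * sin (real j * y)) = 0" if "j \<le> n - 1" for j
  proof -
    define \<theta> where "\<theta> = real j * (pi / real n)"
    define C where "C = integral {-pi..pi} (\<lambda>y. f y * cos (real j * y))"
    define S where "S = integral {-pi..pi} (\<lambda>y. f y * sin (real j * y))"
    have C: "- C = cos \<theta> * C + sin \<theta> * S" and S: "- S = cos \<theta> * S - sin \<theta> * C"
      using integral_mult_sincos_shift[OF f, where x = "pi / real n" and j = j]
      by (simp_all add: anti C_def S_def \<theta>_def)
    have "0 \<le> \<theta>" "\<theta> < pi"
      using that n by (auto simp: \<theta>_def field_simps)
    then have "cos \<theta> > cos pi"
      by (intro cos_monotone_0_pi) auto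
    moreover have "(1 + cos \<theta>) * (C\<^sup>2 + S\<^sup>2) = 0"
      using C S by algebra
    ultimately have "C\<^sup>2 + S\<^sup>2 = 0" by simp
    then show ?thesis
      by (simp add: C_def S_def)
  qed
  then show ?thesis
    using f by (simp add: trig_perp_iff)
qed

section \<open>The Poisson kernel\<close>

text \<open>
  The kernel \<open>1 + 2 (\<Sum>j\<ge>1. e^{-js} cos(jy))\<close> of radius \<open>e^{-s}\<close>, in closed form. With \<open>s\<close> as the
  coordinate it is harmonic in \<open>(y,s)\<close>, and \<open>conj_poisson\<close> is its harmonic conjugate.
\<close>
definition poisson :: "real \<Rightarrow> real \<Rightarrow> real" where
  "poisson s y = sinh s / (cosh s - cos y)"

definition conj_poisson :: "real \<Rightarrow> real \<Rightarrow> real" where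
  "conj_poisson s y = sin y / (cosh s - cos y)"

definition poisson_mean :: "(real \<Rightarrow> real) \<Rightarrow> real \<Rightarrow> real" where
  "poisson_mean h s = integral {-pi..pi} (\<lambda>y. h y * poisson s y) / (2 * pi)"

definition conj_poisson_mean :: "(real \<Rightarrow> real) \<Rightarrow> real \<Rightarrow> real" where
  "conj_poisson_mean h s = integral {-pi..pi} (\<lambda>y. h y * conj_poisson s y) / (2 * pi)"

lemma poisson_denom_pos: "s > 0 \<Longrightarrow> cosh s - cos y > (0::real)"
  using cosh_real_strict_mono[of 0 s] cos_le_one[of y] unfolding cosh_0 by linarith

lemma poisson_pos: "s > 0 \<Longrightarrow> poisson s y > 0"
  unfolding poisson_def using poisson_denom_pos[of s y] by (intro divide_pos_pos) auto

text \<open>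
  The Cauchy--Riemann equations \<open>\<partial>_s P = - \<partial>_y Q\<close> and \<open>\<partial>_s Q = \<partial>_y P\<close> for the kernel \<open>P\<close> and its
  conjugate \<open>Q\<close>.
\<close>
lemma DERIV_poisson:
  assumes "s > 0"
  shows "((\<lambda>s. poisson s y) has_real_derivative
            ((1 - cosh s * cos y) / (cosh s - cos y)\<^sup>2)) (at s within A)"
    and "((\<lambda>y. poisson s y) has_real_derivative
            (- sinh s * sin y / (cosh s - cos y)\<^sup>2)) (at y within B)"
    and "((\<lambda>s. conj_poisson s y) has_real_derivative
            (- sinh s * sin y / (cosh s - cos y)\<^sup>2)) (at s within A)"
    and "((\<lambda>y. conj_poisson s y) has_real_derivative
            (- ((1 - cosh s * cos y) / (cosh s - cos y)\<^sup>2))) (at y within B)"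
proof -
  have nz: "cosh s - cos y \<noteq> 0"
    using poisson_denom_pos[OF assms, of y] by simp
  have hyp: "cosh s * cosh s = 1 + sinh s * sinh s"
    using hyperbolic_pythagoras[of s] by (simp add: power2_eq_square)
  have pyth: "sin y * sin y = 1 - cos y * cos y"
    using sin_cos_squared_add[of y] by (simp add: power2_eq_square algebra_simps)
  show "((\<lambda>s. poisson s y) has_real_derivative
            ((1 - cosh s * cos y) / (cosh s - cos y)\<^sup>2)) (at s within A)"
    unfolding poisson_def
    by (rule derivative_eq_intros refl nz)+
      (simp add: power2_eq_square right_diff_distrib hyp mult.commute)
  show "((\<lambda>y. poisson s y) has_real_derivative
            (- sinh s * sin y / (cosh s - cos y)\<^sup>2)) (at y within B)"
    unfolding poisson_def
    by (rule derivative_eq_intros refl nz)+ (simp add: power2_eq_square)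
  show "((\<lambda>s. conj_poisson s y) has_real_derivative
            (- sinh s * sin y / (cosh s - cos y)\<^sup>2)) (at s within A)"
    unfolding conj_poisson_def
    by (rule derivative_eq_intros refl nz)+ (simp add: power2_eq_square)
  show "((\<lambda>y. conj_poisson s y) has_real_derivative
            (- ((1 - cosh s * cos y) / (cosh s - cos y)\<^sup>2))) (at y within B)"
    unfolding conj_poisson_def
    by (rule derivative_eq_intros refl nz)+
      (simp add: power2_eq_square right_diff_distrib pyth minus_divide_left mult.commute)
qed

lemma continuous_on_poisson: "s > 0 \<Longrightarrow> continuous_on A (poisson s)"
  using DERIV_continuous_on[OF DERIV_poisson(2)] by blast

lemma continuous_on_conj_poisson: "s > 0 \<Longrightarrow> continuous_on A (conj_poisson s)"
  using DERIV_continuous_on[OF DERIV_poisson(4)] by blast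

text \<open>
  By the Cauchy--Riemann equations an \<open>s\<close>-derivative of the kernel is a \<open>y\<close>-derivative of the conjugate
  kernel, which integration by parts moves to \<open>h\<close>. The boundary term of the first
  step vanishes because the conjugate kernel is 0 at \<open>\<plusminus>\<pi>\<close>, that of the second
  because the values of \<open>h1\<close> and of the kernel at the two ends agree.
  The exceptional set \<open>X\<close> admits functions whose second derivative jumps; for them the
  integration by parts also delivers the integrability of \<open>h2\<close> against the kernel.
\<close>
lemma poisson_mean_second_derivative:
  fixes h h1 h2 :: "real \<Rightarrow> real"
  assumes X: "finite X"
    and cont: "continuous_on {-pi..pi} h" "continuous_on {-pi..pi} h1"
    and deriv: "\<And>y. y \<in> {-pi<..<pi} - X \<Longrightarrow> (h has_real_derivative h1 y) (at y)"
               "\<And>y. y \<in> {-pi<..<pi} - X \<Longrightarrow> (h1 has_real_derivative h2 y) (at y)"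
    and per: "h1 pi = h1 (- pi)"
    and s: "s > 0"
  shows "(poisson_mean h has_real_derivative conj_poisson_mean h1 s) (at s)"
    and "(conj_poisson_mean h1 has_real_derivative - poisson_mean h2 s) (at s)"
    and "(\<lambda>y. h2 y * poisson s y) integrable_on {-pi..pi}"
proof -
  define D where "D s y = (1 - cosh s * cos y) / (cosh s - cos y)\<^sup>2" for s y :: real
  define E where "E s y = - sinh s * sin y / (cosh s - cos y)\<^sup>2" for s y :: real
  have nz: "(\<forall>z\<in>{0::real<..} \<times> S. (cosh (fst z) - cos (snd z))\<^sup>2 \<noteq> 0)" for S :: "real set"
  proof
    fix z :: "real \<times> real" assume "z \<in> {0::real<..} \<times> S"
    then show "(cosh (fst z) - cos (snd z))\<^sup>2 \<noteq> 0"
      using poisson_denom_pos[of "fst z" "snd z"] by auto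
  qed
  have contD: "continuous_on ({0<..} \<times> S) (\<lambda>(s, y). D s y)"
    and contE: "continuous_on ({0<..} \<times> S) (\<lambda>(s, y). E s y)" for S
    unfolding D_def E_def split_beta by (rule continuous_intros nz)+
  have cont_snd: "continuous_on ({0<..} \<times> {-pi..pi}) (\<lambda>z. k (snd z))"
    if "continuous_on {-pi..pi} k" for k :: "real \<Rightarrow> real"
    by (rule continuous_on_compose2[OF that]) (auto intro: continuous_intros)
  have contDs: "continuous_on S (D s)" and contEs: "continuous_on S (E s)" for S
    unfolding D_def E_def using poisson_denom_pos[OF s]
    by (intro continuous_intros ballI; simp add: less_imp_neq[THEN not_sym])+
  have at: "at s within {0<..} = at s"
    using s by (simp add: at_within_open[of s "{0<..}"])

  have "((\<lambda>s. integral (cbox (-pi) pi) (\<lambda>y. h y * poisson s y)) has_real_derivative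
          integral (cbox (-pi) pi) (\<lambda>y. h y * D s y)) (at s within {0<..})"
  proof (rule leibniz_rule_field_derivative)
    show "((\<lambda>s. h y * poisson s y) has_real_derivative h y * D s y) (at s within {0<..})"
      if "s \<in> {0<..}" for s y
      unfolding D_def using that by (intro DERIV_cmult DERIV_poisson) auto
    show "(\<lambda>y. h y * poisson s y) integrable_on cbox (-pi) pi" if "s \<in> {0<..}" for s
      using that cont by (intro integrable_continuous continuous_intros continuous_on_poisson)
        (auto simp: cbox_interval)
    show "continuous_on ({0<..} \<times> cbox (-pi) pi) (\<lambda>(s, y). h y * D s y)"
      using contD[of "{-pi..pi}"] cont_snd[OF cont(1)]
      by (simp add: split_beta cbox_interval) (intro continuous_intros)
  qed (use s in auto)
  then have 1: "(poisson_mean h has_real_derivative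
      integral {-pi..pi} (\<lambda>y. h y * D s y) / (2 * pi)) (at s)"
    unfolding poisson_mean_def at by (intro DERIV_cdivide) (simp add: cbox_interval)
  have int1: "(\<lambda>y. h1 y * conj_poisson s y) integrable_on {-pi..pi}"
    using s by (intro integrable_continuous_real continuous_intros continuous_on_conj_poisson cont)
  have "((\<lambda>y. - D s y * h y) has_integral
          - integral {-pi..pi} (\<lambda>y. h1 y * conj_poisson s y)) {-pi..pi}"
  proof (rule integration_by_parts_interior_strong[OF bounded_bilinear_mult X,
        where f = "conj_poisson s" and g' = h1])
    show "((\<lambda>y. conj_poisson s y * h1 y) has_integral conj_poisson s pi * h pi -
        conj_poisson s (- pi) * h (- pi) - - integral {-pi..pi} (\<lambda>y. h1 y * conj_poisson s y)) {-pi..pi}"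
      using integrable_integral[OF int1] by (simp add: conj_poisson_def mult.commute)
    show "(conj_poisson s has_vector_derivative - D s y) (at y)" for y
      using DERIV_poisson(4)[OF s, of y UNIV]
      by (simp add: D_def has_real_derivative_iff_has_vector_derivative)
  qed (use deriv cont s in \<open>auto simp: continuous_on_conj_poisson has_real_derivative_iff_has_vector_derivative\<close>)
  then have "((\<lambda>y. - (h y * D s y)) has_integral
          - integral {-pi..pi} (\<lambda>y. h1 y * conj_poisson s y)) {-pi..pi}"
    by (simp add: mult.commute)
  then have "integral {-pi..pi} (\<lambda>y. h y * D s y) = integral {-pi..pi} (\<lambda>y. h1 y * conj_poisson s y)"
    unfolding has_integral_neg_iff minus_minus by (rule integral_unique)
  with 1 show "(poisson_mean h has_real_derivative conj_poisson_mean h1 s) (at s)"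
    by (simp add: conj_poisson_mean_def)

  have "((\<lambda>s. integral (cbox (-pi) pi) (\<lambda>y. h1 y * conj_poisson s y)) has_real_derivative
          integral (cbox (-pi) pi) (\<lambda>y. h1 y * E s y)) (at s within {0<..})"
  proof (rule leibniz_rule_field_derivative)
    show "((\<lambda>s. h1 y * conj_poisson s y) has_real_derivative h1 y * E s y) (at s within {0<..})"
      if "s \<in> {0<..}" for s y
      unfolding E_def using that by (intro DERIV_cmult DERIV_poisson) auto
    show "(\<lambda>y. h1 y * conj_poisson s y) integrable_on cbox (-pi) pi" if "s \<in> {0<..}" for s
      using that cont by (intro integrable_continuous continuous_intros continuous_on_conj_poisson)
        (auto simp: cbox_interval)
    show "continuous_on ({0<..} \<times> cbox (-pi) pi) (\<lambda>(s, y). h1 y * E s y)"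
      using contE[of "{-pi..pi}"] cont_snd[OF cont(2)]
      by (simp add: split_beta cbox_interval) (intro continuous_intros)
  qed (use s in auto)
  then have 2: "(conj_poisson_mean h1 has_real_derivative
      integral {-pi..pi} (\<lambda>y. h1 y * E s y) / (2 * pi)) (at s)"
    unfolding conj_poisson_mean_def at by (intro DERIV_cdivide) (simp add: cbox_interval)
  have int2: "(\<lambda>y. h1 y * E s y) integrable_on {-pi..pi}"
    by (intro integrable_continuous_real continuous_intros contEs cont)
  have "((\<lambda>y. h2 y * poisson s y) has_integral
          - integral {-pi..pi} (\<lambda>y. h1 y * E s y)) {-pi..pi}"
  proof (rule integration_by_parts_interior_strong[OF bounded_bilinear_mult X,
        where f = h1 and g' = "E s"])
    show "((\<lambda>y. h1 y * E s y) has_integral h1 pi * poisson s pi -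
        h1 (- pi) * poisson s (- pi) - - integral {-pi..pi} (\<lambda>y. h1 y * E s y)) {-pi..pi}"
      using integrable_integral[OF int2] by (simp add: poisson_def per)
    show "(poisson s has_vector_derivative E s y) (at y)" for y
      using DERIV_poisson(2)[OF s, of y UNIV]
      by (simp add: E_def has_real_derivative_iff_has_vector_derivative)
  qed (use deriv cont s in \<open>auto simp: continuous_on_poisson has_real_derivative_iff_has_vector_derivative\<close>)
  then show "(\<lambda>y. h2 y * poisson s y) integrable_on {-pi..pi}"
    and "(conj_poisson_mean h1 has_real_derivative - poisson_mean h2 s) (at s)"
    using 2 by (auto simp: poisson_mean_def dest: integral_unique)
qed

text \<open>
  With the Chebyshev polynomial \<open>T_n\<close>, the left-hand side is \<open>T_n(cosh s) - T_n(cos y)\<close>, hence divisible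
  by \<open>cosh s - cos y\<close> with a quotient of degree \<open>n - 1\<close> in \<open>cos y\<close>. The induction runs along the
  three-term recurrence of \<open>T_n\<close>.
\<close>
lemma poisson_factor:
  "\<exists>\<tau>\<in>trig_poly (n - 1). \<forall>y. cosh (real n * s) - cos (real n * y) = (cosh s - cos y) * \<tau> y"
proof (induction n rule: induct_nat_012)
  case 0
  show ?case
    by (intro bexI[of _ "\<lambda>y. 0 * cos (real 0 * y) + 0 * cos (real 0 * y)"] trig_poly_lincomb cos_in_trig_poly) auto
next
  case 1
  show ?case
    using cos_in_trig_poly[of 0 0] by (intro bexI[of _ "\<lambda>y. cos (real 0 * y)"]) auto
next
  case (ge2 n)
  obtain \<sigma> where \<sigma>: "\<sigma> \<in> trig_poly (n - 1)"
    "\<And>y. cosh (real n * s) - cos (real n * y) = (cosh s - cos y) * \<sigma> y"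
    using ge2(1) by blast
  obtain \<tau> where \<tau>: "\<tau> \<in> trig_poly n"
    "\<And>y. cosh (real (Suc n) * s) - cos (real (Suc n) * y) = (cosh s - cos y) * \<tau> y"
    using ge2(2) by auto
  define \<rho> where
    "\<rho> y = 1 * ((2 * cosh s) * \<tau> y + (- 1) * \<sigma> y) + 2 * cos (real (Suc n) * y)" for y
  have "\<rho> \<in> trig_poly (Suc n)"
    unfolding \<rho>_def
    by (intro trig_poly_lincomb cos_in_trig_poly trig_poly_mono[OF \<sigma>(1)] trig_poly_mono[OF \<tau>(1)]) auto
  moreover have "cosh (real (Suc (Suc n)) * s) - cos (real (Suc (Suc n)) * y) = (cosh s - cos y) * \<rho> y"
    for y
  proof -
    have "cosh (real (Suc n) * s + s) + cosh (real (Suc n) * s - s) = 2 * cosh s * cosh (real (Suc n) * s)"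
      unfolding cosh_add cosh_diff by simp
    then have ch: "cosh (real (Suc (Suc n)) * s) + cosh (real n * s) = 2 * cosh s * cosh (real (Suc n) * s)"
      by (simp add: algebra_simps)
    have "cos (real (Suc n) * y + y) + cos (real (Suc n) * y - y) = 2 * cos y * cos (real (Suc n) * y)"
      unfolding cos_add cos_diff by simp
    then have co: "cos (real (Suc (Suc n)) * y) + cos (real n * y) = 2 * cos y * cos (real (Suc n) * y)"
      by (simp add: algebra_simps)
    show ?thesis
      using ch co \<sigma>(2)[of y] \<tau>(2)[of y] unfolding \<rho>_def by algebra
  qed
  ultimately show ?case by auto
qed

text \<open>
  Modulo polynomials of degree less than \<open>n\<close>, the positive Poisson kernel may be replaced by a kernel with
  the sign of \<open>cos(ny)\<close> whose size is at most \<open>1 / cosh(ns)\<close> of the original. For \<open>n \<ge> 1\<close> the function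
  \<open>sgn (cos(ny))\<close> is itself orthogonal to these polynomials, so no other choice has a smaller \<open>L_1\<close> norm.
\<close>
lemma poisson_mod_trig_poly:
  assumes "s > 0"
  obtains \<tau> where "\<tau> \<in> trig_poly (n - 1)"
    "\<And>y. poisson s y = cos (real n * y) * poisson s y / cosh (real n * s) + \<tau> y"
proof -
  obtain \<tau> where \<tau>: "\<tau> \<in> trig_poly (n - 1)"
    "\<And>y. cosh (real n * s) - cos (real n * y) = (cosh s - cos y) * \<tau> y"
    using poisson_factor by blast
  define c where "c = sinh s / cosh (real n * s)"
  have "(\<lambda>y. c * \<tau> y + 0 * \<tau> y) \<in> trig_poly (n - 1)"
    by (intro trig_poly_lincomb \<tau>)
  moreover have "poisson s y = cos (real n * y) * poisson s y / cosh (real n * s) + (c * \<tau> y + 0 * \<tau> y)" for y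
  proof -
    have "\<tau> y = (cosh (real n * s) - cos (real n * y)) / (cosh s - cos y)"
      using \<tau>(2)[of y] poisson_denom_pos[OF assms, of y] by (simp add: field_simps)
    moreover have "cosh (real n * s) \<noteq> 0"
      using cosh_real_pos[of "real n * s"] by linarith
    moreover have "S / d = k * (S / d) / C + S / C * ((C - k) / d)" if "C \<noteq> 0" "d \<noteq> 0"
      for S C k d :: real
      using that by (simp add: field_simps)
    ultimately show ?thesis
      using poisson_denom_pos[OF assms, of y] by (simp add: poisson_def c_def)
  qed
  ultimately show ?thesis using that by blast
qed

text \<open>
  Orthogonality is stated by Fourier coefficients, and integrability against the kernel is assumed,
  so that the lemma covers the discontinuous function \<open>sgn (cos(ny))\<close>.
\<close>
lemma poisson_mean_orthogonal:
  assumes int: "\<And>j. j \<le> n - 1 \<Longrightarrow> ((\<lambda>y. h y * cos (real j * y)) has_integral 0) {-pi..pi}"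
    "\<And>j. j \<le> n - 1 \<Longrightarrow> ((\<lambda>y. h y * sin (real j * y)) has_integral 0) {-pi..pi}"
    and s: "s > 0"
    and hP: "(\<lambda>y. h y * poisson s y) integrable_on {-pi..pi}"
  shows "poisson_mean h s =
    integral {-pi..pi} (\<lambda>y. h y * cos (real n * y) * poisson s y) / (2 * pi * cosh (real n * s))"
proof -
  obtain \<tau> where \<tau>: "\<tau> \<in> trig_poly (n - 1)"
    "\<And>y. poisson s y = cos (real n * y) * poisson s y / cosh (real n * s) + \<tau> y"
    using poisson_mod_trig_poly[OF s] by blast
  obtain a b where *: "\<And>x. \<tau> x = (\<Sum>j\<le>n - 1. a j * cos (real j * x) + b j * sin (real j * x))"
    using \<tau> by (auto simp: trig_poly_def)
  have "((\<lambda>y. \<Sum>j\<le>n - 1. a j * (h y * cos (real j * y)) + b j * (h y * sin (real j * y)))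
      has_integral (\<Sum>j\<le>n - 1. a j * 0 + b j * 0)) {-pi..pi}"
    by (intro has_integral_sum has_integral_add has_integral_mult_right int) auto
  then have "((\<lambda>y. h y * \<tau> y) has_integral 0) {-pi..pi}"
    by (simp add: * sum_distrib_left algebra_simps)
  with integrable_integral[OF hP]
  have "((\<lambda>y. h y * poisson s y - h y * \<tau> y) has_integral
      integral {-pi..pi} (\<lambda>y. h y * poisson s y) - 0) {-pi..pi}"
    by (rule has_integral_diff)
  moreover have "h y * poisson s y - h y * \<tau> y =
    h y * cos (real n * y) * poisson s y / cosh (real n * s)" for y
    using arg_cong[OF \<tau>(2)[of y], of "(*) (h y)"] by (simp add: algebra_simps)
  ultimately have "((\<lambda>y. h y * cos (real n * y) * poisson s y / cosh (real n * s)) has_integral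
      integral {-pi..pi} (\<lambda>y. h y * poisson s y)) {-pi..pi}"
    by simp
  from integral_unique[OF this, symmetric] show ?thesis
    by (simp add: poisson_mean_def mult.commute)
qed

text \<open>
  The normalised \<open>L_1\<close> norm of the kernel \<open>cos(ny) P_s(y) / cosh(ns)\<close>, which represents the Poisson
  integral on the functions orthogonal to degree less than \<open>n\<close>.
\<close>
definition perp_kernel_norm :: "nat \<Rightarrow> real \<Rightarrow> real" where
  "perp_kernel_norm n s =
     integral {-pi..pi} (\<lambda>y. \<bar>cos (real n * y)\<bar> * poisson s y) / (2 * pi * cosh (real n * s))"

lemma poisson_mean_trig_perp_bound:
  assumes h: "h \<in> trig_perp (n - 1)" and s: "s > 0" and M: "\<And>y. \<bar>h y\<bar> \<le> M"
  shows "\<bar>poisson_mean h s\<bar> \<le> M * perp_kernel_norm n s"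
proof -
  have [continuous_intros]: "continuous_on S h" for S
    using h by (auto simp: trig_perp_def intro: periodic_contD)
  note [continuous_intros] = continuous_on_poisson[OF s]
  have "norm (integral {-pi..pi} (\<lambda>y. h y * cos (real n * y) * poisson s y))
      \<le> integral {-pi..pi} (\<lambda>y. M * (\<bar>cos (real n * y)\<bar> * poisson s y))"
  proof (rule integral_norm_bound_integral)
    show "norm (h y * cos (real n * y) * poisson s y) \<le> M * (\<bar>cos (real n * y)\<bar> * poisson s y)" for y
      using mult_right_mono[OF M[of y], of "\<bar>cos (real n * y)\<bar> * poisson s y"] poisson_pos[OF s, of y]
      by (simp add: abs_mult mult.assoc)
  qed (intro integrable_continuous_real continuous_intros)+
  then have "\<bar>integral {-pi..pi} (\<lambda>y. h y * cos (real n * y) * poisson s y)\<bar> / (2 * pi * cosh (real n * s))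
      \<le> M * integral {-pi..pi} (\<lambda>y. \<bar>cos (real n * y)\<bar> * poisson s y) / (2 * pi * cosh (real n * s))"
    unfolding real_norm_def by (intro divide_right_mono) (auto simp: cosh_real_nonneg)
  moreover have "poisson_mean h s =
    integral {-pi..pi} (\<lambda>y. h y * cos (real n * y) * poisson s y) / (2 * pi * cosh (real n * s))"
  proof (rule poisson_mean_orthogonal[OF _ _ s])
    show "((\<lambda>y. h y * cos (real j * y)) has_integral 0) {-pi..pi}"
      "((\<lambda>y. h y * sin (real j * y)) has_integral 0) {-pi..pi}" if "j \<le> n - 1" for j
      using h that unfolding trig_perp_iff has_integral_iff
      by (auto intro!: integrable_continuous_real continuous_intros)
  qed (intro integrable_continuous_real continuous_intros)
  ultimately show ?thesis
    by (simp add: perp_kernel_norm_def abs_mult cosh_real_nonneg)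
qed

text \<open>
  The mean value of the kernel has zero \<open>s\<close>-derivative, by the derivative formula for a constant function,
  and the kernel tends to 1 uniformly as \<open>s \<rightarrow> \<infinity>\<close>.
\<close>
lemma integral_poisson:
  assumes "s > 0"
  shows "integral {-pi..pi} (poisson s) = 2 * pi"
proof -
  have D: "(poisson_mean (\<lambda>y. 1) has_real_derivative 0) (at s)" if "s > 0" for s
    using poisson_mean_second_derivative(1)[of "{}" "\<lambda>y. 1" "\<lambda>y. 0" "\<lambda>y. 0" s] that
    by (simp add: conj_poisson_mean_def)
  have "\<exists>c. \<forall>t\<in>{0<..}. poisson_mean (\<lambda>y. 1) t = c"
    by (rule has_field_derivative_zero_constant)
      (auto intro: has_field_derivative_at_within D)
  then have eq: "poisson_mean (\<lambda>y. 1) t = poisson_mean (\<lambda>y. 1) s" if "t > 0" for t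
    using that assms by force
  have "filterlim (\<lambda>t::real. t / 2) at_top at_top"
    by (rule filterlim_at_top_mult_tendsto_pos[of "\<lambda>_. 1 / 2" "1 / 2" _ "\<lambda>t. t", simplified]) 
      (auto intro: filterlim_ident)
  then have tanh: "((\<lambda>t::real. tanh (t / 2)) \<longlongrightarrow> 1) at_top"
    by (rule filterlim_compose[OF tanh_real_at_top])
  have half: "sinh t / (cosh t + 1) = tanh (t / 2)" "sinh t / (cosh t - 1) = inverse (tanh (t / 2))" for t :: real
  proof -
    have "sinh t = 2 * sinh (t / 2) * cosh (t / 2)"
      "cosh t + 1 = 2 * cosh (t / 2) * cosh (t / 2)" "cosh t - 1 = 2 * sinh (t / 2) * sinh (t / 2)"
      using sinh_double[of "t / 2"] cosh_double[of "t / 2"] hyperbolic_pythagoras[of "t / 2"]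
      by (simp_all add: power2_eq_square)
    then show "sinh t / (cosh t + 1) = tanh (t / 2)" "sinh t / (cosh t - 1) = inverse (tanh (t / 2))"
      by (simp_all add: tanh_def)
  qed
  have lim: "((\<lambda>t. sinh t / (cosh t + 1)) \<longlongrightarrow> (1::real)) at_top"
    "((\<lambda>t. sinh t / (cosh t - 1)) \<longlongrightarrow> (1::real)) at_top"
    using tanh tendsto_inverse[OF tanh] by (simp_all add: half)
  have "(poisson_mean (\<lambda>y. 1) \<longlongrightarrow> 1) at_top"
  proof (rule tendsto_sandwich[OF _ _ lim])
    have "sinh t / (cosh t + 1) \<le> poisson_mean (\<lambda>y. 1) t \<and>
          poisson_mean (\<lambda>y. 1) t \<le> sinh t / (cosh t - 1)" if t: "t > 0" for t
    proof -
      have int: "poisson t integrable_on {-pi..pi}"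
        by (intro integrable_continuous_real continuous_on_poisson t)
      have "integral {-pi..pi} (\<lambda>y. sinh t / (cosh t + 1)) \<le> integral {-pi..pi} (poisson t)"
      proof (rule integral_le[OF _ int])
        show "sinh t / (cosh t + 1) \<le> poisson t y" for y
          unfolding poisson_def using t poisson_denom_pos[OF t, of y]
            cos_ge_minus_one[of y] by (intro divide_left_mono mult_pos_pos) (auto simp: cosh_real_nonneg add_pos_nonneg add_nonneg_pos)
      qed auto
      moreover have "integral {-pi..pi} (poisson t) \<le> integral {-pi..pi} (\<lambda>y. sinh t / (cosh t - 1))"
      proof (rule integral_le[OF int])
        show "poisson t y \<le> sinh t / (cosh t - 1)" for y
          unfolding poisson_def using t poisson_denom_pos[OF t, of y]
            poisson_denom_pos[OF t, of 0] by (intro divide_left_mono mult_pos_pos) auto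
      qed auto
      ultimately show ?thesis
        by (simp add: poisson_mean_def field_simps)
    qed
    then show "\<forall>\<^sub>F t in at_top. sinh t / (cosh t + 1) \<le> poisson_mean (\<lambda>y. 1) t"
      "\<forall>\<^sub>F t in at_top. poisson_mean (\<lambda>y. 1) t \<le> sinh t / (cosh t - 1)"
      by (auto intro: eventually_mono[OF eventually_gt_at_top[of 0]])
  qed
  moreover have "(poisson_mean (\<lambda>y. 1) \<longlongrightarrow> poisson_mean (\<lambda>y. 1) s) at_top"
    by (rule tendsto_eventually) (auto intro: eventually_mono[OF eventually_gt_at_top[of 0]] eq)
  ultimately have "poisson_mean (\<lambda>y. 1) s = 1"
    using tendsto_unique trivial_limit_at_top_linorder by blast
  then show ?thesis
    by (simp add: poisson_mean_def)
qed

lemma perp_kernel_norm_le: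
  assumes s: "s > 0"
  shows "perp_kernel_norm n s \<le> 2 * exp (- real n * s)"
proof -
  note [continuous_intros] = continuous_on_poisson[OF s]
  have int: "(\<lambda>y. \<bar>cos (real n * y)\<bar> * poisson s y) integrable_on {-pi..pi}"
    by (intro integrable_continuous_real continuous_intros)
  have "integral {-pi..pi} (\<lambda>y. \<bar>cos (real n * y)\<bar> * poisson s y) \<le> integral {-pi..pi} (poisson s)"
  proof (rule integral_le[OF int])
    show "\<bar>cos (real n * y)\<bar> * poisson s y \<le> poisson s y" for y
      using poisson_pos[OF s, of y] by (simp add: mult_left_le_one_le)
  qed (intro integrable_continuous_real continuous_intros)
  then have "perp_kernel_norm n s \<le> 2 * pi / (2 * pi * cosh (real n * s))"
    unfolding perp_kernel_norm_def integral_poisson[OF s]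
    by (intro divide_right_mono) (auto simp: cosh_real_nonneg)
  also have "\<dots> = 1 / cosh (real n * s)" by simp
  also have "\<dots> \<le> 1 / (exp (real n * s) / 2)"
    by (intro divide_left_mono mult_pos_pos cosh_real_pos) (auto simp: cosh_field_def)
  finally show "perp_kernel_norm n s \<le> 2 * exp (- real n * s)"
    by (simp add: exp_minus inverse_eq_divide)
qed

text \<open>
  Continuity at 0 and boundedness give \<open>|h(y) - h(0)| \<le> \<epsilon> + K (1 - cos y)\<close> on the whole period, and the
  kernel satisfies \<open>(1 - cos y) P_s(y) \<le> sinh s\<close>, which tends to 0.
\<close>
lemma poisson_mean_tendsto:
  assumes cont: "continuous_on {-pi..pi} h"
  shows "(poisson_mean h \<longlongrightarrow> h 0) (at_right 0)"
proof -
  have "compact (h ` {-pi..pi})"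
    by (intro compact_continuous_image cont compact_Icc)
  then obtain M where M: "\<And>x. x \<in> {-pi..pi} \<Longrightarrow> \<bar>h x\<bar> \<le> M"
    by (metis bounded_iff compact_imp_bounded imageI real_norm_def)
  then have "M \<ge> 0" using abs_ge_zero[of "h 0"] order_trans pi_ge_zero
    by (metis atLeastAtMost_iff neg_le_0_iff_le)
  have est: "\<bar>poisson_mean h s - h 0\<bar> \<le> \<epsilon> + K * sinh s"
    if s: "s > 0" and pt: "\<And>y. y \<in> {-pi..pi} \<Longrightarrow> \<bar>h y - h 0\<bar> \<le> \<epsilon> + K * (1 - cos y)" and K: "K \<ge> 0" for s \<epsilon> K
  proof -
    note [continuous_intros] = continuous_on_poisson[OF s] cont
    have intP: "poisson s integrable_on {-pi..pi}"
      by (intro integrable_continuous_real continuous_intros)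
    have "poisson_mean h s - h 0 = integral {-pi..pi} (\<lambda>y. h y * poisson s y) / (2 * pi)
        - integral {-pi..pi} (\<lambda>y. h 0 * poisson s y) / (2 * pi)"
      by (simp add: poisson_mean_def integral_poisson[OF s])
    also have "\<dots> = integral {-pi..pi} (\<lambda>y. h y * poisson s y - h 0 * poisson s y) / (2 * pi)"
      unfolding diff_divide_distrib[symmetric]
      by (subst Henstock_Kurzweil_Integration.integral_diff)
        (auto intro!: integrable_continuous_real continuous_intros)
    finally have *: "poisson_mean h s - h 0 =
      integral {-pi..pi} (\<lambda>y. h y * poisson s y - h 0 * poisson s y) / (2 * pi)" .
    have "norm (integral {-pi..pi} (\<lambda>y. h y * poisson s y - h 0 * poisson s y)) \<le>
        integral {-pi..pi} (\<lambda>y. \<epsilon> * poisson s y + K * sinh s)"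
    proof (rule integral_norm_bound_integral)
      fix y assume y: "y \<in> {-pi..pi}"
      have "norm (h y * poisson s y - h 0 * poisson s y) = \<bar>h y - h 0\<bar> * poisson s y"
        using poisson_pos[OF s, of y] by (simp add: abs_mult left_diff_distrib[symmetric])
      also have "\<dots> \<le> (\<epsilon> + K * (1 - cos y)) * poisson s y"
        using poisson_pos[OF s, of y] by (intro mult_right_mono pt y) auto
      also have "(1 - cos y) * poisson s y \<le> sinh s"
      proof -
        have "(1 - cos y) * sinh s \<le> (cosh s - cos y) * sinh s"
          using cosh_real_ge_1[of s] s by (intro mult_right_mono) auto
        then show ?thesis
          using poisson_denom_pos[OF s, of y] unfolding poisson_def by (simp add: field_simps)
      qed
      then have "(\<epsilon> + K * (1 - cos y)) * poisson s y \<le> \<epsilon> * poisson s y + K * sinh s"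
        using mult_left_mono[OF _ K, of "(1 - cos y) * poisson s y" "sinh s"] by (simp add: algebra_simps)
      finally show "norm (h y * poisson s y - h 0 * poisson s y) \<le> \<epsilon> * poisson s y + K * sinh s" .
    qed (intro integrable_continuous_real continuous_intros)+
    also have "\<dots> = integral {-pi..pi} (\<lambda>y. \<epsilon> * poisson s y) + integral {-pi..pi} (\<lambda>y. K * sinh s)"
      by (intro Henstock_Kurzweil_Integration.integral_add integrable_continuous_real continuous_intros)
    also have "\<dots> = 2 * pi * (\<epsilon> + K * sinh s)"
      by (simp add: integral_poisson[OF s] algebra_simps)
    finally show ?thesis
      unfolding * by (simp add: field_simps)
  qed
  have sinh0: "((\<lambda>s. K * sinh s) \<longlongrightarrow> 0) (at_right 0)" for K :: real
  proof -
    have "((\<lambda>s. K * sinh s) \<longlongrightarrow> K * sinh 0) (at_right (0::real))"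
      by (intro tendsto_intros)
    then show ?thesis by simp
  qed
  show ?thesis
  proof (rule tendstoI)
    fix e :: real assume e: "e > 0"
    have "continuous (at 0 within {-pi..pi}) h"
      using cont by (auto simp: continuous_on_eq_continuous_within)
    then obtain d where d: "d > 0" "\<And>y. y \<in> {-pi..pi} \<Longrightarrow> \<bar>y\<bar> < d \<Longrightarrow> \<bar>h y - h 0\<bar> < e / 2"
      using e unfolding continuous_within_eps_delta 
      by (metis diff_zero dist_real_def half_gt_zero)
    define \<delta> where "\<delta> = min d pi"
    have \<delta>: "0 < \<delta>" "\<delta> \<le> pi" "\<delta> \<le> d" using d by (auto simp: \<delta>_def)
    then have c: "1 - cos \<delta> > 0"
      using cos_monotone_0_pi[of 0 \<delta>] by simp
    define K where "K = 2 * M / (1 - cos \<delta>)"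
    have K: "K \<ge> 0" using c \<open>M \<ge> 0\<close> by (simp add: K_def)
    have pt: "\<bar>h y - h 0\<bar> \<le> e / 2 + K * (1 - cos y)" if y: "y \<in> {-pi..pi}" for y
    proof (cases "\<bar>y\<bar> < \<delta>")
      case True
      then show ?thesis using d(2)[OF y] \<delta> K by (simp add: add_increasing2 less_imp_le)
    next
      case False
      have "cos \<bar>y\<bar> \<le> cos \<delta>"
        using False y \<delta> by (intro cos_monotone_0_pi_le) auto
      then have "K * (1 - cos y) \<ge> K * (1 - cos \<delta>)"
        using K by (intro mult_left_mono) auto
      moreover have "K * (1 - cos \<delta>) = 2 * M" using c by (simp add: K_def)
      moreover have "\<bar>h y - h 0\<bar> \<le> 2 * M"
        using M[OF y] M[of 0] by auto
      ultimately show ?thesis using e by simp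
    qed
    have "\<forall>\<^sub>F s in at_right 0. K * sinh s < e / 2"
      using order_tendstoD(2)[OF sinh0[of K], of "e / 2"] e by simp
    then show "\<forall>\<^sub>F s in at_right 0. dist (poisson_mean h s) (h 0) < e"
      using eventually_at_right_less[of 0]
    proof eventually_elim
      case (elim s)
      then show ?case using est[OF elim(2) pt K] by (simp add: dist_real_def)
    qed
  qed
qed

section \<open>Convexity at infinity and second antiderivatives\<close>

text \<open>
  A convex function with a finite limit at infinity cannot have a positive slope anywhere; it decreases
  to its limit. This serves as the comparison principle in the variable \<open>s\<close>.
\<close>
lemma nonneg_if_convex_vanishing_at_infinity:
  fixes z z' z'' :: "real \<Rightarrow> real"
  assumes z: "\<And>s. s > 0 \<Longrightarrow> (z has_real_derivative z' s) (at s)"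
    and z': "\<And>s. s > 0 \<Longrightarrow> (z' has_real_derivative z'' s) (at s)"
    and convex: "\<And>s. s > 0 \<Longrightarrow> z'' s \<ge> 0"
    and lim: "(z \<longlongrightarrow> 0) at_top"
    and s: "s > 0"
  shows "z s \<ge> 0"
proof -
  have mono: "z' a \<le> z' b" if "0 < a" "a \<le> b" for a b
    using that by (intro DERIV_nonneg_imp_nondecreasing[of a b z']) (auto intro!: exI z' convex)
  have nonpos: "z' a \<le> 0" if a: "a > 0" for a
  proof (rule ccontr)
    assume "\<not> z' a \<le> 0"
    then have pos: "z' a > 0" by simp
    have ge: "z a + z' a * (b - a) \<le> z b" if ab: "b > a" for b
    proof -
      obtain c where "a < c" "c < b" "z b - z a = (b - a) * z' c"
        using MVT2[of a b z z'] z a ab by force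
      moreover have "(b - a) * z' a \<le> (b - a) * z' c"
        using a ab \<open>a < c\<close> by (intro mult_left_mono mono) auto
      ultimately show ?thesis
        unfolding mult.commute[of "z' a"] by linarith
    qed
    have "\<forall>\<^sub>F b in at_top. z b < 1"
      using order_tendstoD(2)[OF lim, of 1] by simp
    moreover have "\<forall>\<^sub>F b in at_top. b > a + (1 + \<bar>z a\<bar>) / z' a"
      by (rule eventually_gt_at_top)
    ultimately have "\<forall>\<^sub>F b in at_top. z b < 1 \<and> b > a + (1 + \<bar>z a\<bar>) / z' a"
      by (rule eventually_conj)
    then obtain b where b: "z b < 1" "b > a + (1 + \<bar>z a\<bar>) / z' a"
      using eventually_happens'[OF trivial_limit_at_top_linorder] by blast
    then have "(1 + \<bar>z a\<bar>) / z' a < b - a" by simp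
    then have "1 + \<bar>z a\<bar> < z' a * (b - a)"
      using pos by (simp add: field_simps)
    moreover have "b > a" using b(2) pos by (smt (verit) divide_nonneg_pos)
    ultimately show False using ge[of b] b(1) by linarith
  qed
  have "z b \<le> z s" if "b \<ge> s" for b
    using that s by (intro DERIV_nonpos_imp_nonincreasing[of s b z]) (auto intro!: exI z nonpos)
  then have "\<forall>\<^sub>F b in at_top. z b \<le> z s"
    by (rule eventually_mono[OF eventually_ge_at_top[of s]])
  then show ?thesis
    by (rule tendsto_upperbound[OF lim]) simp
qed

lemma periodic_antiderivative:
  assumes f: "f \<in> periodic_cont" and mean: "integral {-pi..pi} f = 0"
  obtains G where "G \<in> periodic_cont" "integral {-pi..pi} G = 0"
    "\<And>x. (G has_real_derivative f x) (at x)"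
proof -
  have "\<exists>G. \<forall>x::real. -\<infinity> < ereal x \<longrightarrow> ereal x < \<infinity> \<longrightarrow> (G has_vector_derivative f x) (at x)"
    by (rule einterval_antiderivative)
      (use periodic_contD(1)[OF f, of UNIV] in \<open>auto simp: continuous_on_eq_continuous_at\<close>)
  then obtain G where G: "\<And>x. (G has_real_derivative f x) (at x)"
    unfolding has_real_derivative_iff_has_vector_derivative by auto
  have Gint: "(f has_integral (G pi - G (- pi))) {-pi..pi}"
    by (rule fundamental_theorem_of_calculus)
      (auto intro!: has_field_derivative_at_within G
        simp: has_real_derivative_iff_has_vector_derivative[symmetric])
  have "((\<lambda>x. G (x + 2 * pi) - G x) has_real_derivative 0) (at x)" for x
  proof -
    have "((\<lambda>x. G (x + 2 * pi)) has_real_derivative f (x + 2 * pi)) (at x)"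
      using G[of "x + 2 * pi"] by (rule DERIV_shift[THEN iffD1])
    from DERIV_diff[OF this G[of x]] show ?thesis
      by (simp add: periodic_contD(2)[OF f])
  qed
  then have const: "G (x + 2 * pi) - G x = G (- pi + 2 * pi) - G (- pi)" for x
    by (intro DERIV_isconst_all) auto
  have "G pi = G (- pi)"
    using integral_unique[OF Gint] mean by simp
  then have Gper: "G (x + 2 * pi) = G x" for x
    using const[of x] by simp
  have contG: "continuous_on S G" for S
    using G by (meson DERIV_isCont continuous_at_imp_continuous_on)
  define c where "c = integral {-pi..pi} G / (2 * pi)"
  show ?thesis
  proof
    show "(\<lambda>x. G x - c) \<in> periodic_cont"
      by (auto simp: periodic_cont_def Gper intro!: continuous_intros contG)
    have "integral {-pi..pi} (\<lambda>x. G x - c) = integral {-pi..pi} G - integral {-pi..pi} (\<lambda>x. c)"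
      by (intro Henstock_Kurzweil_Integration.integral_diff integrable_continuous_real
          continuous_intros contG)
    then show "integral {-pi..pi} (\<lambda>x. G x - c) = 0"
      by (simp add: c_def)
    show "((\<lambda>x. G x - c) has_real_derivative f x) (at x)" for x
      using DERIV_diff[OF G DERIV_const] by simp
  qed
qed

text \<open>
  The Fourier coefficients of a second derivative at frequency \<open>j\<close> are \<open>-j^2\<close> times those of the
  function. As before, the second derivative may fail to exist at finitely many points.
\<close>
lemma has_integral_second_derivative_mult_sincos:
  fixes h h1 h2 :: "real \<Rightarrow> real" and j :: nat
  assumes X: "finite X"
    and cont: "continuous_on {-pi..pi} h" "continuous_on {-pi..pi} h1"
    and deriv: "\<And>y. y \<in> {-pi<..<pi} - X \<Longrightarrow> (h has_real_derivative h1 y) (at y)"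
               "\<And>y. y \<in> {-pi<..<pi} - X \<Longrightarrow> (h1 has_real_derivative h2 y) (at y)"
    and per: "h pi = h (- pi)" "h1 pi = h1 (- pi)"
  shows "((\<lambda>y. h2 y * cos (real j * y)) has_integral
           - (real j)\<^sup>2 * integral {-pi..pi} (\<lambda>y. h y * cos (real j * y))) {-pi..pi}" (is ?C)
    and "((\<lambda>y. h2 y * sin (real j * y)) has_integral
           - (real j)\<^sup>2 * integral {-pi..pi} (\<lambda>y. h y * sin (real j * y))) {-pi..pi}" (is ?S)
proof -
  have twice: "((\<lambda>y. h2 y * w y) has_integral integral {-pi..pi} (\<lambda>y. h y * w'' y)) {-pi..pi}"
    if w: "\<And>y. (w has_real_derivative w' y) (at y)" "\<And>y. (w' has_real_derivative w'' y) (at y)"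
      and w'': "\<And>S. continuous_on S w''" and wper: "w pi = w (- pi)" "w' pi = w' (- pi)"
    for w w' w'' :: "real \<Rightarrow> real"
  proof -
    have contw: "continuous_on S w" "continuous_on S w'" for S
      using w by (meson DERIV_isCont continuous_at_imp_continuous_on)+
    have int: "(\<lambda>y. h y * w'' y) integrable_on {-pi..pi}"
      by (intro integrable_continuous_real continuous_intros cont w'')
    have *: "((\<lambda>y. h1 y * w' y) has_integral - integral {-pi..pi} (\<lambda>y. h y * w'' y)) {-pi..pi}"
      by (rule integration_by_parts_interior_strong[OF bounded_bilinear_mult X,
            where f = h and g' = w''])
        (use deriv cont contw w integrable_integral[OF int] in
          \<open>auto simp: has_real_derivative_iff_has_vector_derivative per wper\<close>)
    show ?thesis
      by (rule integration_by_parts_interior_strong[OF bounded_bilinear_mult X,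
            where f = h1 and g' = w'])
        (use deriv cont contw w * in
          \<open>auto simp: has_real_derivative_iff_has_vector_derivative per wper\<close>)
  qed
  have "((\<lambda>y. h2 y * cos (real j * y)) has_integral
      integral {-pi..pi} (\<lambda>y. h y * (- (real j)\<^sup>2 * cos (real j * y)))) {-pi..pi}"
    by (rule twice[where w' = "\<lambda>y. - real j * sin (real j * y)"])
      (auto intro!: derivative_eq_intros continuous_intros simp: power2_eq_square)
  moreover have "integral {-pi..pi} (\<lambda>y. h y * (- (real j)\<^sup>2 * cos (real j * y))) =
      integral {-pi..pi} (\<lambda>y. - (real j)\<^sup>2 * (h y * cos (real j * y)))"
    by (simp add: mult_ac)
  ultimately show ?C by simp
  have "((\<lambda>y. h2 y * sin (real j * y)) has_integral
      integral {-pi..pi} (\<lambda>y. h y * (- (real j)\<^sup>2 * sin (real j * y)))) {-pi..pi}"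
    by (rule twice[where w' = "\<lambda>y. real j * cos (real j * y)"])
      (auto intro!: derivative_eq_intros continuous_intros simp: power2_eq_square)
  moreover have "integral {-pi..pi} (\<lambda>y. h y * (- (real j)\<^sup>2 * sin (real j * y))) =
      integral {-pi..pi} (\<lambda>y. - (real j)\<^sup>2 * (h y * sin (real j * y)))"
    by (simp add: mult_ac)
  ultimately show ?S by simp
qed

text \<open>
  The constants of integration make \<open>F1\<close> and \<open>F\<close> have mean zero, which is orthogonality at frequency 0; at
  the other frequencies the coefficients of \<open>F\<close> are those of \<open>f\<close> divided by \<open>-j^2\<close>.
\<close>
lemma trig_perp_second_antiderivative:
  assumes f: "f \<in> trig_perp m"
  obtains F F1 where "F \<in> trig_perp m" "F1 \<in> periodic_cont"
    "\<And>x. (F has_real_derivative F1 x) (at x)" "\<And>x. (F1 has_real_derivative f x) (at x)"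
proof -
  have per: "f \<in> periodic_cont" and perp: "\<And>j. j \<le> m \<Longrightarrow> integral {-pi..pi} (\<lambda>x. f x * cos (real j * x)) = 0"
    "\<And>j. j \<le> m \<Longrightarrow> integral {-pi..pi} (\<lambda>x. f x * sin (real j * x)) = 0"
    using f by (auto simp: trig_perp_iff)
  have "integral {-pi..pi} f = 0"
    using perp(1)[of 0] by simp
  then obtain F1 where F1: "F1 \<in> periodic_cont" "integral {-pi..pi} F1 = 0"
    "\<And>x. (F1 has_real_derivative f x) (at x)"
    using periodic_antiderivative[OF per] by blast
  obtain F where F: "F \<in> periodic_cont" "integral {-pi..pi} F = 0"
    "\<And>x. (F has_real_derivative F1 x) (at x)"
    using periodic_antiderivative[OF F1(1,2)] by blast
  note ibp = has_integral_second_derivative_mult_sincos[of "{}" F F1 f, THEN integral_unique,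
    OF finite.emptyI periodic_contD(1)[OF F(1)] periodic_contD(1)[OF F1(1)] F(3) F1(3)
      periodic_contD(3)[OF F(1)] periodic_contD(3)[OF F1(1)]]
  have "integral {-pi..pi} (\<lambda>x. F x * cos (real j * x)) = 0 \<and>
        integral {-pi..pi} (\<lambda>x. F x * sin (real j * x)) = 0" if "j \<le> m" for j
  proof (cases "j = 0")
    case True
    then show ?thesis using F(2) by simp
  next
    case False
    have "- (real j)\<^sup>2 * integral {-pi..pi} (\<lambda>y. F y * cos (real j * y)) = 0"
      "- (real j)\<^sup>2 * integral {-pi..pi} (\<lambda>y. F y * sin (real j * y)) = 0"
      unfolding ibp[symmetric] by (rule perp[OF that])+
    then show ?thesis using False by simp
  qed
  then have "F \<in> trig_perp m"
    using F(1) by (simp add: trig_perp_iff)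
  then show ?thesis
    using that F1 F by blast
qed

section \<open>The extremal comparison function\<close>

text \<open>
  For \<open>|x| \<le> \<pi>/(2n)\<close> the expression \<open>arcsin (sin (n x)) / n\<close> is \<open>x\<close>, and the formula reads
  \<open>(cos(\<mu>x) / cos(\<mu>\<pi>/(2n)) - 1) / \<mu>^2\<close>, which vanishes at both ends of that interval. Elsewhere the
  triangle wave \<open>arcsin (sin (n x)) / n\<close> and the factor \<open>sgn (cos (n x))\<close> continue it so that a
  translation by \<open>\<pi>/n\<close> changes its sign.
\<close>
definition comparison :: "nat \<Rightarrow> real \<Rightarrow> real \<Rightarrow> real" where
  "comparison n \<mu> x = sgn (cos (real n * x)) *
     ((cos (\<mu> * (arcsin (sin (real n * x)) / real n)) / cos (\<mu> * pi / (2 * real n)) - 1) / \<mu>\<^sup>2)"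

text \<open>
  The slope of the triangle wave is \<open>sgn (cos (n x))\<close>, which cancels against the sign factor of \<open>comparison\<close>.
  This makes the derivative continuous.
\<close>
definition comparison_deriv :: "nat \<Rightarrow> real \<Rightarrow> real \<Rightarrow> real" where
  "comparison_deriv n \<mu> x =
     - (sin (\<mu> * (arcsin (sin (real n * x)) / real n)) / (\<mu> * cos (\<mu> * pi / (2 * real n))))"

lemma continuous_on_arcsin_sin: "continuous_on S (\<lambda>x. arcsin (sin (real n * x)))"
  by (intro continuous_on_arcsin continuous_intros) (auto simp: sin_ge_minus_one)

text \<open>
  Away from the zeros of \<open>cos(nx)\<close> the sign is locally constant, so both formulas are chain rules. The second
  derivative is \<open>-\<mu>^2 Z - sgn (cos(nx))\<close>, the equation for which \<open>Z\<close> was chosen.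
\<close>
lemma DERIV_comparison:
  assumes n: "n \<ge> 1" and \<mu>: "0 < \<mu>" "\<mu> < real n" and cos: "cos (real n * x) \<noteq> 0"
  shows "(comparison n \<mu> has_real_derivative comparison_deriv n \<mu> x) (at x)"
    and "(comparison_deriv n \<mu> has_real_derivative - (\<mu>\<^sup>2 * comparison n \<mu> x + sgn (cos (real n * x)))) (at x)"
proof -
  define c where "c = cos (\<mu> * pi / (2 * real n))"
  have "c > 0"
    unfolding c_def using \<mu> n by (intro cos_gt_zero) (auto simp: field_simps)
  define \<sigma> where "\<sigma> = sgn (cos (real n * x))"
  define \<rho> where "\<rho> t = arcsin (sin (real n * t)) / real n" for t
  have \<sigma>\<sigma>: "\<sigma> * (\<sigma> * b) = b" for b
    using cos by (auto simp: \<sigma>_def sgn_if)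
  have "\<bar>sin (real n * x)\<bar> < 1"
  proof -
    have "(sin (real n * x))\<^sup>2 < 1"
      using cos sin_cos_squared_add[of "real n * x"] zero_less_power2[of "cos (real n * x)"] by linarith
    then show ?thesis by (simp add: abs_square_less_1)
  qed
  then have b: "-1 < sin (real n * x)" "sin (real n * x) < 1" by auto
  have "sqrt (1 - (sin (real n * x))\<^sup>2) = \<bar>cos (real n * x)\<bar>"
    by (simp add: cos_squared_eq[symmetric])
  then have \<rho>: "(\<rho> has_real_derivative \<sigma>) (at x)"
    unfolding \<rho>_def[abs_def] using n cos
    by (auto intro!: derivative_eq_intros b b[unfolded mult.commute[of "real n"]]
        simp: \<sigma>_def sgn_if field_simps)
  have "((\<lambda>t. sgn (cos (real n * t))) has_real_derivative 0) (at x)"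
  proof (rule has_field_derivative_transform_within_open[of "\<lambda>t. \<sigma>"])
    show "open {t. cos (real n * t) * \<sigma> > 0}"
      by (intro open_Collect_less continuous_intros)
    show "x \<in> {t. cos (real n * t) * \<sigma> > 0}" 
      using cos by (auto simp: \<sigma>_def sgn_if)
    show "\<sigma> = sgn (cos (real n * t))" if "t \<in> {t. cos (real n * t) * \<sigma> > 0}" for t
      using that unfolding \<sigma>_def by (auto simp: sgn_if zero_less_mult_iff split: if_splits)
  qed simp
  moreover have cos_\<rho>: "((\<lambda>t. cos (\<mu> * \<rho> t)) has_real_derivative - sin (\<mu> * \<rho> x) * (\<mu> * \<sigma>)) (at x)"
    by (auto intro!: derivative_eq_intros \<rho>)
  have "((\<lambda>t. (cos (\<mu> * \<rho> t) / c - 1) / \<mu>\<^sup>2) has_real_derivative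
      (- sin (\<mu> * \<rho> x) * (\<mu> * \<sigma>) / c - 0) / \<mu>\<^sup>2) (at x)"
    by (intro DERIV_cdivide DERIV_diff DERIV_const cos_\<rho>)
  ultimately have "(comparison n \<mu> has_real_derivative
      0 * ((cos (\<mu> * \<rho> x) / c - 1) / \<mu>\<^sup>2)
      + (- sin (\<mu> * \<rho> x) * (\<mu> * \<sigma>) / c - 0) / \<mu>\<^sup>2 * \<sigma>) (at x)"
    unfolding comparison_def[abs_def] c_def[symmetric] \<rho>_def[symmetric] \<sigma>_def
    by (rule DERIV_mult)
  then show "(comparison n \<mu> has_real_derivative comparison_deriv n \<mu> x) (at x)"
    using \<mu> \<sigma>\<sigma> unfolding comparison_deriv_def c_def[symmetric] \<rho>_def[symmetric]
    by (simp add: power2_eq_square mult_ac)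
  have "(comparison_deriv n \<mu> has_real_derivative - (cos (\<mu> * \<rho> x) * (\<mu> * \<sigma>) / (\<mu> * c))) (at x)"
    unfolding comparison_deriv_def[abs_def] c_def[symmetric] \<rho>_def[symmetric]
    using \<rho> \<open>c > 0\<close> \<mu> by (auto intro!: derivative_eq_intros)
  moreover have "- (cos (\<mu> * \<rho> x) * (\<mu> * \<sigma>) / (\<mu> * c)) = - (\<mu>\<^sup>2 * comparison n \<mu> x + \<sigma>)"
    using \<mu> \<open>c > 0\<close> unfolding comparison_def c_def[symmetric] \<rho>_def[symmetric] \<sigma>_def[symmetric]
    by (simp add: field_simps)
  ultimately show "(comparison_deriv n \<mu> has_real_derivative
      - (\<mu>\<^sup>2 * comparison n \<mu> x + sgn (cos (real n * x)))) (at x)"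
    by (simp add: \<sigma>_def)
qed

lemma finite_cos_zeros: "n \<ge> 1 \<Longrightarrow> finite {x. \<bar>x\<bar> \<le> pi \<and> cos (real n * x) = 0}"
proof (rule finite_subset)
  assume n: "n \<ge> 1"
  show "{x. \<bar>x\<bar> \<le> pi \<and> cos (real n * x) = 0} \<subseteq>
    (\<lambda>i. of_int i * (pi / 2) / real n) ` {- (2 * int n)..2 * int n}"
  proof
    fix x assume "x \<in> {x. \<bar>x\<bar> \<le> pi \<and> cos (real n * x) = 0}"
    then have x: "\<bar>x\<bar> \<le> pi" "cos (real n * x) = 0" by auto
    obtain i :: int where i: "real n * x = of_int i * (pi / 2)"
      using x(2) unfolding cos_zero_iff_int by blast
    have "\<bar>of_int i * (pi / 2)\<bar> \<le> real n * pi"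
      unfolding i[symmetric] using x(1) by (simp add: abs_mult mult_left_mono)
    then have "\<bar>real_of_int i\<bar> * pi \<le> (2 * real n) * pi"
      by (simp add: abs_mult)
    then have "\<bar>real_of_int i\<bar> \<le> 2 * real n"
      by (simp only: mult_le_cancel_right_pos[OF pi_gt_zero])
    then have "i \<in> {- (2 * int n)..2 * int n}" by auto
    moreover have "x = of_int i * (pi / 2) / real n"
      using i n by (simp add: field_simps)
    ultimately show "x \<in> (\<lambda>i. of_int i * (pi / 2) / real n) ` {- (2 * int n)..2 * int n}"
      by (rule rev_image_eqI)
  qed
qed simp

lemma comparison_at_0:
  "comparison n \<mu> 0 = (1 / cos (\<mu> * pi / (2 * real n)) - 1) / \<mu>\<^sup>2"
  by (simp add: comparison_def)

lemma comparison_antiperiodic: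
  assumes "n \<ge> 1"
  shows "comparison n \<mu> (pi / real n + x) = - comparison n \<mu> x"
proof -
  have "real n * (pi / real n + x) = pi + real n * x"
    using assms by (simp add: field_simps)
  then have "cos (real n * (pi / real n + x)) = - cos (real n * x)"
    "sin (real n * (pi / real n + x)) = - sin (real n * x)"
    by (simp_all add: cos_add sin_add)
  moreover have "arcsin (- sin (real n * x)) = - arcsin (sin (real n * x))"
    by (rule arcsin_minus) (auto simp: sin_ge_minus_one)
  ultimately show ?thesis
    by (simp add: comparison_def sgn_minus)
qed

text \<open>
  The sign factor jumps only at zeros of \<open>cos(nx)\<close>, and there the other factor vanishes, so the product is
  continuous; orthogonality then comes from antiperiodicity.
\<close>
lemma comparison_trig_perp:
  assumes n: "n \<ge> 1" and \<mu>: "0 < \<mu>" "\<mu> < real n"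
  shows "comparison n \<mu> \<in> trig_perp (n - 1)"
proof (rule antiperiodic_in_trig_perp[OF _ n])
  show "comparison n \<mu> (pi / real n + x) = - comparison n \<mu> x" for x
    by (rule comparison_antiperiodic[OF n])
next
  define c where "c = cos (\<mu> * pi / (2 * real n))"
  have "c > 0"
    unfolding c_def using \<mu> n by (intro cos_gt_zero) (auto simp: field_simps)
  define \<zeta> where "\<zeta> x = (cos (\<mu> * (arcsin (sin (real n * x)) / real n)) / c - 1) / \<mu>\<^sup>2" for x
  have comp: "comparison n \<mu> x = sgn (cos (real n * x)) * \<zeta> x" for x
    by (simp add: comparison_def \<zeta>_def c_def)
  have "continuous_on UNIV \<zeta>"
    unfolding \<zeta>_def[abs_def]
    by (intro continuous_intros continuous_on_arcsin_sin) (use \<open>c > 0\<close> \<mu> n in auto)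
  have "isCont (comparison n \<mu>) x" for x
  proof (cases "cos (real n * x) = 0")
    case False
    then show ?thesis using DERIV_comparison(1)[OF n \<mu>] DERIV_isCont by blast
  next
    case True
    then have "(sin (real n * x))\<^sup>2 = 1"
      using sin_cos_squared_add[of "real n * x"] by simp
    then have "sin (real n * x) = 1 \<or> sin (real n * x) = - 1"
      by (simp add: power2_eq_1_iff)
    then have "\<zeta> x = 0"
      using \<open>c > 0\<close> by (auto simp: \<zeta>_def c_def)
    moreover have "(\<zeta> \<longlongrightarrow> \<zeta> x) (at x)"
      using \<open>continuous_on UNIV \<zeta>\<close> by (simp add: continuous_on_eq_continuous_at isCont_def)
    ultimately have "((\<lambda>t. \<bar>\<zeta> t\<bar>) \<longlongrightarrow> 0) (at x)"
      by (simp add: tendsto_rabs_zero)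
    then have "(comparison n \<mu> \<longlongrightarrow> 0) (at x)"
      by (rule Lim_null_comparison[rotated])
        (auto intro!: always_eventually simp: comp abs_mult abs_sgn_eq)
    then show ?thesis
      by (simp add: isCont_def comp True)
  qed
  then have "continuous_on UNIV (comparison n \<mu>)"
    by (simp add: continuous_at_imp_continuous_on)
  moreover have "comparison n \<mu> (x + 2 * pi) = comparison n \<mu> x" for x
    by (simp only: comparison_def sincos_mult_period)
  ultimately show "comparison n \<mu> \<in> periodic_cont"
    by (simp add: periodic_cont_def)
qed

text \<open>
  The Poisson integral of \<open>Z\<close> has second derivative \<open>-P_s Z'' = \<mu>^2 P_s Z + P_s (sgn (cos(ny)))\<close>. The function
  \<open>sgn (cos(ny))\<close> is a combination of \<open>Z\<close> and \<open>Z''\<close>, hence orthogonal to low frequencies, and it has the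
  same sign as the reduced kernel; so its Poisson integral is exactly the \<open>L_1\<close> norm of that kernel.
\<close>
lemma comparison_poisson_mean:
  assumes n: "n \<ge> 1" and \<mu>: "0 < \<mu>" "\<mu> < real n" and s: "s > 0"
  shows "(poisson_mean (comparison n \<mu>) has_real_derivative
           conj_poisson_mean (comparison_deriv n \<mu>) s) (at s)"
    and "(conj_poisson_mean (comparison_deriv n \<mu>) has_real_derivative
           \<mu>\<^sup>2 * poisson_mean (comparison n \<mu>) s + perp_kernel_norm n s) (at s)"
proof -
  define Z where "Z = comparison n \<mu>"
  define h2 where "h2 y = - (\<mu>\<^sup>2 * Z y + sgn (cos (real n * y)))" for y
  define X where "X = {x. \<bar>x\<bar> \<le> pi \<and> cos (real n * x) = 0}"
  have Z: "Z \<in> trig_perp (n - 1)"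
    unfolding Z_def by (rule comparison_trig_perp[OF n \<mu>])
  then have Zper: "Z \<in> periodic_cont" by (simp add: trig_perp_iff)
  have "cos (\<mu> * pi / (2 * real n)) > 0"
    using \<mu> n by (intro cos_gt_zero) (auto simp: field_simps)
  then have c1: "continuous_on S (comparison_deriv n \<mu>)" for S
    unfolding comparison_deriv_def[abs_def] using \<mu> n
    by (intro continuous_intros continuous_on_arcsin_sin) auto
  have deriv: "(Z has_real_derivative comparison_deriv n \<mu> y) (at y)"
    "(comparison_deriv n \<mu> has_real_derivative h2 y) (at y)" if "y \<in> {-pi<..<pi} - X" for y
    using that DERIV_comparison[OF n \<mu>, of y] by (auto simp: X_def Z_def h2_def abs_le_iff)
  have per1: "comparison_deriv n \<mu> pi = comparison_deriv n \<mu> (- pi)"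
    using sincos_mult_period[of n "- pi"] by (simp add: comparison_deriv_def)
  have X: "finite X"
    unfolding X_def by (rule finite_cos_zeros[OF n])
  note sd = poisson_mean_second_derivative[OF X periodic_contD(1)[OF Zper] c1 deriv per1 s]
  note sc = has_integral_second_derivative_mult_sincos[OF X periodic_contD(1)[OF Zper] c1 deriv
      periodic_contD(3)[OF Zper] per1]
  show "(poisson_mean (comparison n \<mu>) has_real_derivative
           conj_poisson_mean (comparison_deriv n \<mu>) s) (at s)"
    using sd(1) by (simp add: Z_def)
  note [continuous_intros] = periodic_contD(1)[OF Zper] continuous_on_poisson[OF s]
  have combine: "((\<lambda>y. sgn (cos (real n * y)) * w y) has_integral - I - \<mu>\<^sup>2 * J) {-pi..pi}"
    if "((\<lambda>y. h2 y * w y) has_integral I) {-pi..pi}" "((\<lambda>y. Z y * w y) has_integral J) {-pi..pi}"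
    for w I J
  proof -
    have "((\<lambda>y. - (h2 y * w y) - \<mu>\<^sup>2 * (Z y * w y)) has_integral - I - \<mu>\<^sup>2 * J) {-pi..pi}"
      by (intro has_integral_diff has_integral_neg has_integral_mult_right that)
    then show ?thesis by (simp add: h2_def algebra_simps)
  qed
  have ZP: "(\<lambda>y. Z y * poisson s y) integrable_on {-pi..pi}"
    by (intro integrable_continuous_real continuous_intros)
  have \<sigma>P: "((\<lambda>y. sgn (cos (real n * y)) * poisson s y) has_integral
      - integral {-pi..pi} (\<lambda>y. h2 y * poisson s y)
      - \<mu>\<^sup>2 * integral {-pi..pi} (\<lambda>y. Z y * poisson s y)) {-pi..pi}"
    by (rule combine[OF integrable_integral[OF sd(3)] integrable_integral[OF ZP]])
  have \<sigma>: "poisson_mean (\<lambda>y. sgn (cos (real n * y))) s =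
      integral {-pi..pi} (\<lambda>y. sgn (cos (real n * y)) * cos (real n * y) * poisson s y)
      / (2 * pi * cosh (real n * s))"
  proof (rule poisson_mean_orthogonal[OF _ _ s])
    fix j assume j: "j \<le> n - 1"
    have "((\<lambda>y. Z y * cos (real j * y)) has_integral 0) {-pi..pi}"
      "((\<lambda>y. Z y * sin (real j * y)) has_integral 0) {-pi..pi}"
      using Z j unfolding trig_perp_iff has_integral_iff
      by (auto intro!: integrable_continuous_real continuous_intros)
    from combine[OF sc(1) this(1)] combine[OF sc(2) this(2)]
    show "((\<lambda>y. sgn (cos (real n * y)) * cos (real j * y)) has_integral 0) {-pi..pi}"
      "((\<lambda>y. sgn (cos (real n * y)) * sin (real j * y)) has_integral 0) {-pi..pi}"
      using Z j by (simp_all add: trig_perp_iff)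
  qed (use \<sigma>P in \<open>auto simp: has_integral_iff\<close>)
  have "sgn (cos (real n * y)) * cos (real n * y) = \<bar>cos (real n * y)\<bar>" for y
    by (simp add: abs_sgn mult.commute)
  with \<sigma> have "poisson_mean (\<lambda>y. sgn (cos (real n * y))) s = perp_kernel_norm n s"
    by (simp add: perp_kernel_norm_def)
  moreover have "poisson_mean (\<lambda>y. sgn (cos (real n * y))) s =
      - poisson_mean h2 s - \<mu>\<^sup>2 * poisson_mean Z s"
    unfolding poisson_mean_def integral_unique[OF \<sigma>P] by (simp only: diff_divide_distrib minus_divide_left times_divide_eq_right)
  ultimately have "- poisson_mean h2 s = \<mu>\<^sup>2 * poisson_mean Z s + perp_kernel_norm n s"
    by simp
  with sd(2) show "(conj_poisson_mean (comparison_deriv n \<mu>) has_real_derivative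
           \<mu>\<^sup>2 * poisson_mean (comparison n \<mu>) s + perp_kernel_norm n s) (at s)"
    by (simp add: Z_def)
qed

section \<open>Averaging the centered difference\<close>

lemma sum_centered:
  fixes g :: "nat \<Rightarrow> real"
  shows "(\<Sum>i\<le>2 * k. g i) = g k + (\<Sum>i=1..k. g (k + i) + g (k - i))"
proof -
  have "(\<Sum>i\<le>2 * k. g i) = (\<Sum>i\<in>{k} \<union> ({k+1..2*k} \<union> {..<k}). g i)"
    by (rule sum.cong) auto
  also have "\<dots> = g k + ((\<Sum>i=k+1..2*k. g i) + (\<Sum>i<k. g i))"
    by (subst sum.union_disjoint; (subst sum.union_disjoint)?) auto
  also have "(\<Sum>i=k+1..2*k. g i) = (\<Sum>i=1..k. g (k + i))"
    by (rule sum.reindex_bij_witness[of _ "\<lambda>i. k + i" "\<lambda>i. i - k"]) auto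
  also have "(\<Sum>i<k. g i) = (\<Sum>i=1..k. g (k - i))"
    by (rule sum.reindex_bij_witness[of _ "\<lambda>i. k - i" "\<lambda>i. k - i"]) auto
  finally show ?thesis
    by (simp add: sum.distrib)
qed

text \<open>
  Evaluated at \<open>x - kt\<close>, the difference is symmetric about \<open>x\<close>; the factor \<open>(-1)^k\<close> makes the central
  coefficient positive.
\<close>
lemma fin_diff_centered:
  "(-1) ^ k * fin_diff (2 * k) t f (x - real k * t) = real ((2 * k) choose k) * f x +
     (\<Sum>i=1..k. (-1) ^ i * real ((2 * k) choose (k + i)) * (f (x + real i * t) + f (x - real i * t)))"
proof -
  define g where "g i = (-1) ^ k * ((-1) ^ i * real (2 * k choose i) * f (x - real k * t + real i * t))" for i
  have g: "g j = ((-1) ^ k * (-1) ^ j) * real (2 * k choose j) * f (x - real k * t + real j * t)" for j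
    by (simp add: g_def mult.assoc)
  have "(-1) ^ k * fin_diff (2 * k) t f (x - real k * t) = (\<Sum>i\<le>2 * k. g i)"
    by (simp add: fin_diff_def sum_distrib_left g_def)
  also have "\<dots> = g k + (\<Sum>i=1..k. g (k + i) + g (k - i))"
    by (rule sum_centered)
  also have "g k = real ((2 * k) choose k) * f x"
    by (simp add: g_def power_add[symmetric] mult_2[symmetric])
  also have "(\<Sum>i=1..k. g (k + i) + g (k - i)) = (\<Sum>i=1..k. (-1) ^ i *
      real ((2 * k) choose (k + i)) * (f (x + real i * t) + f (x - real i * t)))"
  proof (rule sum.cong[OF refl])
    fix i assume "i \<in> {1..k}"
    then have i: "i \<le> k" by auto
    have "(-1 :: real) ^ k * (-1) ^ (k + i) = (-1) ^ i"
      by (simp add: power_add mult.assoc[symmetric] power_mult_distrib[symmetric])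
    moreover have "x - real k * t + real (k + i) * t = x + real i * t"
      by (simp add: algebra_simps)
    ultimately have plus: "g (k + i) = (-1) ^ i * real ((2 * k) choose (k + i)) * f (x + real i * t)"
      by (simp only: g)
    have "(-1 :: real) ^ k = (-1) ^ (k - i) * (-1) ^ i"
      using i by (simp add: power_add[symmetric])
    then have "(-1 :: real) ^ k * (-1) ^ (k - i) = (-1) ^ i * ((-1) ^ (k - i) * (-1) ^ (k - i))"
      by (simp only: mult_ac)
    then have "(-1 :: real) ^ k * (-1) ^ (k - i) = (-1) ^ i"
      by (simp add: power_mult_distrib[symmetric])
    moreover have "(2 * k) choose (k - i) = (2 * k) choose (k + i)"
      using binomial_symmetric[of "k - i" "2 * k"] i by (simp add: mult_2)
    moreover have "x - real k * t + real (k - i) * t = x - real i * t"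
      using i by (simp add: of_nat_diff algebra_simps)
    ultimately have "g (k - i) = (-1) ^ i * real ((2 * k) choose (k + i)) * f (x - real i * t)"
      by (simp only: g)
    with plus show "g (k + i) + g (k - i) = (-1) ^ i *
        real ((2 * k) choose (k + i)) * (f (x + real i * t) + f (x - real i * t))"
      by (simp only: distrib_left)
  qed
  finally show ?thesis .
qed

lemma fin_diff_0: "r \<ge> 1 \<Longrightarrow> fin_diff r 0 f x = 0"
  using choose_alternating_sum[of r, where 'a = real]
  by (simp add: fin_diff_def sum_distrib_right[symmetric])

lemma abs_fin_diff_le_mod_smooth:
  assumes f: "f \<in> periodic_cont" and t: "0 < t" "t \<le> \<delta>"
  shows "\<bar>fin_diff r t f x\<bar> \<le> mod_smooth r f \<delta>"
proof -
  obtain M where M: "\<And>x. \<bar>f x\<bar> \<le> M"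
    using periodic_cont_bounded[OF f] by blast
  define B where "B = (\<Sum>i\<le>r. real (r choose i) * M)"
  have b: "\<bar>fin_diff r t f x\<bar> \<le> B" for t x
    unfolding fin_diff_def B_def
    by (rule order_trans[OF sum_abs], rule sum_mono) (simp add: abs_mult M mult_left_mono)
  have "\<bar>fin_diff r t f x\<bar> \<le> unif_norm (fin_diff r t f)"
    unfolding unif_norm_def by (rule cSUP_upper) (auto intro!: bdd_aboveI[of _ B] b)
  also have "\<dots> \<le> mod_smooth r f \<delta>"
    unfolding mod_smooth_def
  proof (rule cSUP_upper)
    show "bdd_above ((\<lambda>t. unif_norm (fin_diff r t f)) ` {0<..\<delta>})"
      unfolding unif_norm_def by (rule bdd_aboveI[of _ B]) (auto intro!: cSUP_least b)
  qed (use t in auto)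
  finally show ?thesis .
qed

text \<open>
  Taylor's formula with integral remainder for \<open>t \<mapsto> (F(x+dt) + F(x-dt)) / d^2\<close>, whose first derivative
  vanishes at 0 by symmetry.
\<close>
lemma hat_average_even_part:
  assumes F: "\<And>x. (F has_real_derivative F1 x) (at x)" "\<And>x. (F1 has_real_derivative f x) (at x)"
    and h: "h \<ge> 0" and d: "d \<noteq> 0"
  shows "((\<lambda>t. (h - t) * (f (x + d * t) + f (x - d * t))) has_integral
           (F (x + d * h) + F (x - d * h) - 2 * F x) / d\<^sup>2) {0..h}"
proof -
  \<comment> \<open>an antiderivative of the integrand, found by integrating by parts twice\<close>
  define G where "G t = (h - t) * (F1 (x + d * t) - F1 (x - d * t)) / d
    + (F (x + d * t) + F (x - d * t)) / d\<^sup>2" for t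
  have aff: "((\<lambda>t. x + c * t) has_real_derivative c) (at t)" for c t
    by (auto intro!: derivative_eq_intros)
  have chain:
    "((\<lambda>t. F (x + c * t)) has_real_derivative c * F1 (x + c * t)) (at t)"
    "((\<lambda>t. F1 (x + c * t)) has_real_derivative c * f (x + c * t)) (at t)" for c t
    using DERIV_chain2[OF F(1) aff[of c t]] DERIV_chain2[OF F(2) aff[of c t]]
    by (simp_all only: mult.commute[of _ c])
  have "(G has_real_derivative (h - t) * (f (x + d * t) + f (x - d * t))) (at t)" for t
  proof -
    have "((\<lambda>t. (h - t) * (F1 (x + d * t) - F1 (x + (- d) * t)) / d
       + (F (x + d * t) + F (x + (- d) * t)) / d\<^sup>2) has_real_derivative
      ((0 - 1) * (F1 (x + d * t) - F1 (x + (- d) * t))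
        + (d * f (x + d * t) - (- d) * f (x + (- d) * t)) * (h - t)) / d
       + (d * F1 (x + d * t) + (- d) * F1 (x + (- d) * t)) / d\<^sup>2) (at t)"
      by (intro DERIV_add DERIV_cdivide DERIV_mult DERIV_diff DERIV_const DERIV_ident chain)
    then show ?thesis
      unfolding G_def[abs_def] using d
      by (auto elim!: DERIV_cong simp: field_simps power2_eq_square)
  qed
  then have "((\<lambda>t. (h - t) * (f (x + d * t) + f (x - d * t))) has_integral (G h - G 0)) {0..h}"
    by (intro fundamental_theorem_of_calculus h)
      (auto intro: has_vector_derivative_at_within
        simp: has_real_derivative_iff_has_vector_derivative)
  moreover have "G h - G 0 = (F (x + d * h) + F (x - d * h) - 2 * F x) / d\<^sup>2"
    by (simp add: G_def diff_divide_distrib add_divide_distrib)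
  ultimately show ?thesis by simp
qed

text \<open>
  The hat kernel \<open>2(h-t)/h^2\<close> has mass 1 on \<open>[0,h]\<close>, so averaging with it preserves the bound for the
  centered difference and the central term \<open>f x\<close>, while each symmetric pair turns into a second
  difference of \<open>F\<close>. At \<open>t = 0\<close>, outside the range of the hypothesis, the difference is 0.
\<close>
lemma hat_average_centered_difference:
  assumes F: "\<And>x. (F has_real_derivative F1 x) (at x)" "\<And>x. (F1 has_real_derivative f x) (at x)"
    and h: "h > 0" and k: "k \<ge> 1"
    and \<Omega>: "\<And>t x. 0 < t \<Longrightarrow> t \<le> h \<Longrightarrow> \<bar>fin_diff (2 * k) t f x\<bar> \<le> \<Omega>"
  defines "a \<equiv> \<lambda>i. real ((2 * k) choose (k + i)) / real ((2 * k) choose k)"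
  shows "\<bar>f x + 2 / h\<^sup>2 * (\<Sum>i=1..k. (-1) ^ i * a i / (real i)\<^sup>2 *
            (F (x + real i * h) + F (x - real i * h) - 2 * F x))\<bar> \<le> gamma_star k * \<Omega>"
proof -
  define C where "C = real ((2 * k) choose k)"
  have C: "C > 0" by (simp add: C_def)
  define S where "S t = f x + (\<Sum>i=1..k. (-1) ^ i * a i * (f (x + real i * t) + f (x - real i * t)))" for t
  have "C * S t = (-1) ^ k * fin_diff (2 * k) t f (x - real k * t)" for t
    using C unfolding fin_diff_centered S_def a_def C_def[symmetric]
    by (simp add: distrib_left sum_distrib_left)
  then have S: "S t = (-1) ^ k * fin_diff (2 * k) t f (x - real k * t) / C" for t
    using C by (simp add: field_simps)
  have "\<Omega> \<ge> 0" using \<Omega>[of h] h by (meson abs_ge_zero order_refl order_trans)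
  have Sb: "\<bar>S t\<bar> \<le> \<Omega> / C" if "t \<in> {0..h}" for t
  proof (cases "t = 0")
    case True
    then show ?thesis using C \<open>\<Omega> \<ge> 0\<close> k by (simp add: S fin_diff_0)
  next
    case False
    then show ?thesis
      using that C \<Omega>[of t] unfolding S by (auto simp: abs_mult power_abs intro!: divide_right_mono)
  qed
  define A where "A = (\<Sum>i=1..k. (-1) ^ i * a i / (real i)\<^sup>2 *
            (F (x + real i * h) + F (x - real i * h) - 2 * F x))"
  have tri: "((\<lambda>t. h - t) has_integral h\<^sup>2 / 2) {0..h}"
  proof -
    have "((\<lambda>t. h - t) has_integral (h * h - h\<^sup>2 / 2) - (h * 0 - 0\<^sup>2 / 2)) {0..h}"
      using h by (intro fundamental_theorem_of_calculus)
        (auto intro!: derivative_eq_intros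
          simp: has_real_derivative_iff_has_vector_derivative[symmetric])
    then show ?thesis by (simp add: power2_eq_square)
  qed
  have "((\<lambda>t. f x * (h - t) + (\<Sum>i=1..k. (-1) ^ i * a i *
        ((h - t) * (f (x + real i * t) + f (x - real i * t))))) has_integral
      f x * (h\<^sup>2 / 2) + (\<Sum>i=1..k. (-1) ^ i * a i *
        ((F (x + real i * h) + F (x - real i * h) - 2 * F x) / (real i)\<^sup>2))) {0..h}"
    using h by (intro has_integral_add has_integral_mult_right tri has_integral_sum
        hat_average_even_part[OF F]) auto
  then have "((\<lambda>t. (h - t) * S t) has_integral h\<^sup>2 / 2 * f x + A) {0..h}"
    by (simp add: S_def A_def distrib_left sum_distrib_left mult_ac)
  moreover have "((\<lambda>t. (h - t) * (\<Omega> / C)) has_integral h\<^sup>2 / 2 * (\<Omega> / C)) {0..h}"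
    by (intro has_integral_mult_left tri)
  moreover have "norm ((h - t) * S t) \<le> (h - t) * (\<Omega> / C)" if "t \<in> {0..h}" for t
    using Sb[OF that] that unfolding real_norm_def abs_mult by (intro mult_mono) auto
  ultimately have "\<bar>h\<^sup>2 / 2 * f x + A\<bar> \<le> h\<^sup>2 / 2 * (\<Omega> / C)"
    by (metis (no_types, lifting) has_integral_integrable integral_norm_bound_integral integral_unique real_norm_def)
  then have "2 / h\<^sup>2 * \<bar>h\<^sup>2 / 2 * f x + A\<bar> \<le> 2 / h\<^sup>2 * (h\<^sup>2 / 2 * (\<Omega> / C))"
    by (intro mult_left_mono) auto
  also have "2 / h\<^sup>2 * \<bar>h\<^sup>2 / 2 * f x + A\<bar> = \<bar>2 / h\<^sup>2 * (h\<^sup>2 / 2 * f x + A)\<bar>"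
    unfolding abs_mult by simp
  also have "2 / h\<^sup>2 * (h\<^sup>2 / 2 * f x + A) = f x + 2 / h\<^sup>2 * A"
    using h by (simp add: field_simps)
  also have "2 / h\<^sup>2 * (h\<^sup>2 / 2 * (\<Omega> / C)) = gamma_star k * \<Omega>"
    using h by (simp add: gamma_star_def C_def field_simps)
  finally show ?thesis by (simp add: A_def)
qed

text \<open>
  Removing the absolute value with a sign \<open>\<epsilon> = \<plusminus>1\<close> turns the left-hand side into a sum of
  \<open>a_i (1 + \<epsilon> (-1)^i) / i^2\<close>: only indices of one parity survive, with weight 2. All terms are
  nonnegative, so \<open>a_i\<close> may be replaced by 1 and the sum by the full series. As
  \<open>\<Sum> 1/i^2 = \<pi>^2/6\<close>, the even indices contribute \<open>\<pi>^2/12\<close> and the odd ones \<open>\<pi>^2/4\<close>.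
\<close>
lemma alternating_inverse_squares_bound:
  fixes a :: "nat \<Rightarrow> real"
  assumes a: "\<And>i. 0 \<le> a i \<and> a i \<le> 1"
  shows "(\<Sum>i=1..k. a i / (real i)\<^sup>2) + \<bar>\<Sum>i=1..k. (-1) ^ i * a i / (real i)\<^sup>2\<bar> \<le> pi\<^sup>2 / 4"
proof -
  define B where "B m = (\<Sum>i=1..m. 1 / (real i)\<^sup>2)" for m
  have B: "B \<longlonglongrightarrow> pi\<^sup>2 / 6"
  proof -
    have "B = (\<lambda>m. \<Sum>i<m. 1 / (real i + 1)\<^sup>2)"
      unfolding B_def[abs_def] 
      by (intro ext sum.reindex_bij_witness[of _ "\<lambda>i. i + 1" "\<lambda>i. i - 1"]) auto
    then show ?thesis
      using inverse_squares_sums by (simp add: sums_def add.commute)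
  qed
  define E where "E \<epsilon> m = (\<Sum>i=1..m. (1 + \<epsilon> * (-1) ^ i) / (real i)\<^sup>2)" for \<epsilon> :: real and m
  have even_part: "(\<Sum>i=1..2 * m. (1 + (-1) ^ i) / (real i)\<^sup>2) = B m / 2" for m
  proof (induction m)
    case (Suc m)
    have "(1 + (-1) ^ (2 * Suc m)) / (real (2 * Suc m))\<^sup>2 = 1 / (real (Suc m))\<^sup>2 / 2"
      unfolding of_nat_mult power_mult_distrib by simp
    moreover have "(\<Sum>i=1..2 * Suc m. (1 + (-1) ^ i) / (real i)\<^sup>2) =
        (\<Sum>i=1..2 * m. (1 + (-1) ^ i) / (real i)\<^sup>2) + (1 + (-1) ^ (2 * Suc m)) / (real (2 * Suc m))\<^sup>2"
      by simp
    moreover have "B (Suc m) = B m + 1 / (real (Suc m))\<^sup>2"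
      by (simp add: B_def)
    ultimately show ?case
      using Suc by (simp only: add_divide_distrib)
  qed (simp add: B_def)
  \<comment> \<open>\<open>1 + \<epsilon> (-1)^i = \<epsilon> (1 + (-1)^i) + (1 - \<epsilon>)\<close> reduces both parities to the even part and the full sum.\<close>
  have full: "(\<Sum>i=1..m. \<epsilon> * ((1 + (-1) ^ i) / (real i)\<^sup>2) + (1 - \<epsilon>) * (1 / (real i)\<^sup>2)) = E \<epsilon> m" for \<epsilon> m
    unfolding E_def by (rule sum.cong) (auto simp: field_simps)
  have E: "E \<epsilon> (2 * m) = \<epsilon> * (B m / 2) + (1 - \<epsilon>) * B (2 * m)" for \<epsilon> m
    unfolding full[symmetric] sum.distrib sum_distrib_left[symmetric] even_part B_def ..
  have lim: "(\<lambda>m. E \<epsilon> (2 * m)) \<longlonglongrightarrow> \<epsilon> * (pi\<^sup>2 / 6 / 2) + (1 - \<epsilon>) * (pi\<^sup>2 / 6)" for \<epsilon>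
    unfolding E using B
    by (intro tendsto_intros filterlim_compose[OF B] filterlim_subseq) (auto simp: strict_mono_def)
  have E_mono: "E \<epsilon> k \<le> E \<epsilon> (2 * m)" if \<epsilon>: "\<epsilon> = 1 \<or> \<epsilon> = - 1" and "m \<ge> k" for \<epsilon> k m
    unfolding E_def
  proof (rule sum_mono2)
    show "0 \<le> (1 + \<epsilon> * (- 1) ^ i) / (real i)\<^sup>2" for i
      using \<epsilon> by (intro divide_nonneg_nonneg) (auto simp: minus_one_power_iff)
  qed (use \<open>m \<ge> k\<close> in auto)
  have E_lim: "E \<epsilon> k \<le> \<epsilon> * (pi\<^sup>2 / 6 / 2) + (1 - \<epsilon>) * (pi\<^sup>2 / 6)" if "\<epsilon> = 1 \<or> \<epsilon> = - 1" for \<epsilon>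
    by (rule LIMSEQ_le_const[OF lim]) (use E_mono[OF that] in blast)
  have bound: "(\<Sum>i=1..k. a i / (real i)\<^sup>2) + \<epsilon> * (\<Sum>i=1..k. (-1) ^ i * a i / (real i)\<^sup>2) \<le> pi\<^sup>2 / 4"
    if \<epsilon>: "\<epsilon> = 1 \<or> \<epsilon> = - 1" for \<epsilon>
  proof -
    have "(\<Sum>i=1..k. a i / (real i)\<^sup>2) + \<epsilon> * (\<Sum>i=1..k. (-1) ^ i * a i / (real i)\<^sup>2) =
      (\<Sum>i=1..k. a i * ((1 + \<epsilon> * (-1) ^ i) / (real i)\<^sup>2))"
      unfolding sum_distrib_left sum.distrib[symmetric] by (rule sum.cong) (auto simp: field_simps)
    also have "\<dots> \<le> E \<epsilon> k"
      unfolding E_def using \<epsilon>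
      by (intro sum_mono mult_left_le_one_le)
        (auto intro!: divide_nonneg_nonneg simp: a minus_one_power_iff)
    also have "\<dots> \<le> \<epsilon> * (pi\<^sup>2 / 6 / 2) + (1 - \<epsilon>) * (pi\<^sup>2 / 6)"
      using \<epsilon> by (intro E_lim) auto
    also have "\<dots> \<le> pi\<^sup>2 / 4"
      using \<epsilon> by auto
    finally show ?thesis .
  qed
  show ?thesis
    using bound[of 1] bound[of "-1"] by linarith
qed

section \<open>The bound for a perturbed identity\<close>

lemma poisson_mean_lincomb:
  assumes "finite I" "\<And>i. i \<in> I \<Longrightarrow> continuous_on {-pi..pi} (h i)" "s > 0"
  shows "poisson_mean (\<lambda>y. \<Sum>i\<in>I. c i * h i y) s = (\<Sum>i\<in>I. c i * poisson_mean (h i) s)"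
proof -
  have "integral {-pi..pi} (\<lambda>y. (\<Sum>i\<in>I. c i * h i y) * poisson s y) =
      integral {-pi..pi} (\<lambda>y. \<Sum>i\<in>I. c i * (h i y * poisson s y))"
    by (simp add: sum_distrib_right mult.assoc)
  also have "\<dots> = (\<Sum>i\<in>I. integral {-pi..pi} (\<lambda>y. c i * (h i y * poisson s y)))"
    using assms by (intro integral_sum integrable_continuous_real continuous_intros
        continuous_on_poisson) auto
  finally show ?thesis
    by (simp add: poisson_mean_def sum_divide_distrib)
qed

lemma poisson_mean_diff:
  assumes "continuous_on {-pi..pi} g" "continuous_on {-pi..pi} h" "s > 0"
  shows "poisson_mean (\<lambda>y. g y - h y) s = poisson_mean g s - poisson_mean h s"
proof -
  have "integral {-pi..pi} (\<lambda>y. (g y - h y) * poisson s y) =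
      integral {-pi..pi} (\<lambda>y. g y * poisson s y - h y * poisson s y)"
    by (simp add: left_diff_distrib)
  also have "\<dots> = integral {-pi..pi} (\<lambda>y. g y * poisson s y) - integral {-pi..pi} (\<lambda>y. h y * poisson s y)"
    using assms by (intro Henstock_Kurzweil_Integration.integral_diff integrable_continuous_real
        continuous_intros continuous_on_poisson)
  finally show ?thesis
    by (simp add: poisson_mean_def diff_divide_distrib)
qed

lemma poisson_mean_exp_bound:
  assumes h: "h \<in> trig_perp (n - 1)" and M: "\<And>y. \<bar>h y\<bar> \<le> M" and s: "s > 0"
  shows "\<bar>poisson_mean h s\<bar> \<le> 2 * M * exp (- real n * s)"
proof -
  have "0 \<le> M" using M[of 0] by linarith
  have "\<bar>poisson_mean h s\<bar> \<le> M * perp_kernel_norm n s"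
    by (rule poisson_mean_trig_perp_bound[OF h s M])
  also have "\<dots> \<le> M * (2 * exp (- real n * s))"
    using perp_kernel_norm_le[OF s] \<open>0 \<le> M\<close> by (intro mult_left_mono)
  finally show ?thesis by simp
qed

lemma exp_decay_tendsto_0:
  assumes n: "n \<ge> 1" and b: "\<And>s. s > 0 \<Longrightarrow> \<bar>v s\<bar> \<le> C * exp (- real n * s)"
  shows "(v \<longlongrightarrow> 0) at_top"
proof (rule Lim_null_comparison)
  show "\<forall>\<^sub>F s in at_top. norm (v s) \<le> C * exp (- real n * s)"
    using b by (auto intro: eventually_mono[OF eventually_gt_at_top[of 0]])
  have "filterlim (\<lambda>s. real n * s) at_top at_top"
    using n by (intro filterlim_tendsto_pos_mult_at_top[OF tendsto_const] filterlim_ident) auto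
  then have "filterlim (\<lambda>s. - real n * s) at_bot at_top"
    by (simp add: filterlim_uminus_at_top)
  then have "((\<lambda>s. exp (- real n * s)) \<longlongrightarrow> 0) at_top"
    by (rule filterlim_compose[OF exp_at_bot])
  then show "((\<lambda>s. C * exp (- real n * s)) \<longlongrightarrow> 0) at_top"
    by (rule tendsto_mult_right_zero)
qed

text \<open>
  The sharp estimate behind the theorem; equality occurs in the limit for \<open>f = Z''\<close> smoothed, with \<open>A F\<close>
  equal to \<open>\<mu>^2 F\<close>. The Poisson integral \<open>v\<close> of \<open>F\<close> is compared with \<open>W y\<close>. The differential inequality for
  \<open>v\<close> contains \<open>v\<close> itself, so the comparison is bootstrapped: an error term \<open>K q^m e^{-ns}\<close> is allowed,
  and one application of the convexity principle multiplies it by \<open>q = (\<mu>/n)^2 < 1\<close>, because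
  \<open>e^{-ns}\<close> has second derivative \<open>n^2 e^{-ns}\<close> while the inequality feeds it back with the factor
  \<open>\<mu>^2\<close>.
\<close>
lemma norm_bound_of_perturbed_identity:
  fixes c d :: "'i \<Rightarrow> real"
  assumes n: "n \<ge> 1" and \<mu>: "0 < \<mu>" "\<mu> < real n"
    and f: "f \<in> trig_perp (n - 1)" and F: "F \<in> trig_perp (n - 1)" and F1: "F1 \<in> periodic_cont"
    and deriv: "\<And>x. (F has_real_derivative F1 x) (at x)" "\<And>x. (F1 has_real_derivative f x) (at x)"
    and I: "finite I" and c: "(\<Sum>i\<in>I. \<bar>c i\<bar>) \<le> \<mu>\<^sup>2"
    and W: "\<And>x. \<bar>f x + (\<Sum>i\<in>I. c i * F (x + d i))\<bar> \<le> W"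
  shows "\<bar>f x\<bar> \<le> W / cos (\<mu> * pi / (2 * real n))"
proof -
  define g where "g x = f x + (\<Sum>i\<in>I. c i * F (x + d i))" for x
  define v where "v x = poisson_mean (\<lambda>y. F (x + y))" for x
  define Z where "Z = comparison n \<mu>"
  define y where "y = poisson_mean Z"
  define y' where "y' = conj_poisson_mean (comparison_deriv n \<mu>)"
  have W0: "W \<ge> 0" using W[of 0] by linarith
  have fper: "f \<in> periodic_cont" and Fper: "F \<in> periodic_cont"
    using f F by (auto simp: trig_perp_iff)
  note [continuous_intros] = periodic_contD(1)[OF periodic_cont_shift[OF fper]]
    periodic_contD(1)[OF periodic_cont_shift[OF Fper]]
  have Fsh: "(\<lambda>y. F (x + y)) \<in> trig_perp (n - 1)" for x
    by (rule trig_perp_shift[OF F])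
  obtain M where M: "\<And>x. \<bar>F x\<bar> \<le> M"
    using periodic_cont_bounded[OF Fper] by blast
  have Zp: "Z \<in> trig_perp (n - 1)"
    unfolding Z_def by (rule comparison_trig_perp[OF n \<mu>])
  then have Zper: "Z \<in> periodic_cont" by (simp add: trig_perp_iff)
  obtain MZ where MZ: "\<And>x. \<bar>Z x\<bar> \<le> MZ"
    using periodic_cont_bounded[OF Zper] by blast
  have "g = (\<lambda>x. 1 * f x + 1 * (\<Sum>i\<in>I. c i * F (d i + x) + 0 * F (d i + x)))"
    by (simp add: fun_eq_iff g_def add.commute)
  also have "\<dots> \<in> trig_perp (n - 1)"
    by (intro trig_perp_lincomb trig_perp_sum I f Fsh)
  finally have gp: "g \<in> trig_perp (n - 1)" .
  then have gper: "g \<in> periodic_cont" by (simp add: trig_perp_iff)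
  have chain: "((\<lambda>y. h (x + y)) has_real_derivative h' (x + y)) (at y)"
    if "\<And>x. (h has_real_derivative h' x) (at x)" for h h' :: "real \<Rightarrow> real" and x y
    using that[of "y + x"] DERIV_shift[of h _ y x] by (simp add: add.commute)
  have v': "(v x has_real_derivative conj_poisson_mean (\<lambda>y. F1 (x + y)) s) (at s)"
    and v'': "(conj_poisson_mean (\<lambda>y. F1 (x + y)) has_real_derivative
        - poisson_mean (\<lambda>y. f (x + y)) s) (at s)" if s: "s > 0" for x s
    using poisson_mean_second_derivative(1,2)[of "{}" "\<lambda>y. F (x + y)" "\<lambda>y. F1 (x + y)" "\<lambda>y. f (x + y)" s]
      periodic_contD[OF periodic_cont_shift[OF F1, of x]] periodic_contD(1)[OF periodic_cont_shift[OF Fper, of x]]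
      chain[OF deriv(1)] chain[OF deriv(2)] s
    by (auto simp: v_def)
  have f_bound: "\<bar>poisson_mean (\<lambda>y. f (x + y)) s\<bar> \<le> W * perp_kernel_norm n s + \<mu>\<^sup>2 * B"
    if s: "s > 0" and B: "\<And>x. \<bar>v x s\<bar> \<le> B" for x s B
  proof -
    have B0: "B \<ge> 0" using B[of 0] by linarith
    have "(\<lambda>y. f (x + y)) = (\<lambda>y. g (x + y) - (\<Sum>i\<in>I. c i * F (x + d i + y)))"
      by (auto simp: g_def algebra_simps)
    then have "poisson_mean (\<lambda>y. f (x + y)) s =
        poisson_mean (\<lambda>y. g (x + y) - (\<Sum>i\<in>I. c i * F (x + d i + y))) s"
      by simp
    also have "\<dots> = poisson_mean (\<lambda>y. g (x + y)) s - (\<Sum>i\<in>I. c i * v (x + d i) s)"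
      unfolding v_def using s
      by (subst poisson_mean_diff)
        (auto intro!: continuous_intros poisson_mean_lincomb I periodic_contD(1)[OF periodic_cont_shift[OF gper]])
    finally have "\<bar>poisson_mean (\<lambda>y. f (x + y)) s\<bar> \<le>
        \<bar>poisson_mean (\<lambda>y. g (x + y)) s\<bar> + \<bar>\<Sum>i\<in>I. c i * v (x + d i) s\<bar>"
      by linarith
    also have "\<bar>poisson_mean (\<lambda>y. g (x + y)) s\<bar> \<le> W * perp_kernel_norm n s"
      using W by (intro poisson_mean_trig_perp_bound[OF trig_perp_shift[OF gp] s]) (simp add: g_def)
    also have "\<bar>\<Sum>i\<in>I. c i * v (x + d i) s\<bar> \<le> (\<Sum>i\<in>I. \<bar>c i\<bar> * B)"
      by (rule order_trans[OF sum_abs], rule sum_mono) (simp add: abs_mult B mult_left_mono)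
    also have "\<dots> \<le> \<mu>\<^sup>2 * B"
      unfolding sum_distrib_right[symmetric] by (rule mult_right_mono[OF c B0])
    finally show ?thesis by simp
  qed
  define q where "q = (\<mu> / real n)\<^sup>2"
  \<comment> \<open>\<open>K\<close> absorbs the a priori bounds of both \<open>v\<close> and \<open>y\<close>, so that the iteration can start
      from \<open>|v| \<le> W y + K e^{-ns}\<close> whatever the sign of \<open>y\<close>.\<close>
  define K where "K = 2 * M + W * (2 * MZ)"
  define E where "E s = exp (- real n * s)" for s
  have vE: "\<bar>v x s\<bar> \<le> 2 * M * E s" if "s > 0" for x s
    unfolding v_def E_def by (rule poisson_mean_exp_bound[OF Fsh M that])
  have yE: "\<bar>y s\<bar> \<le> 2 * MZ * E s" if "s > 0" for s
    unfolding y_def E_def by (rule poisson_mean_exp_bound[OF Zp MZ that])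
  have y: "(y has_real_derivative y' s) (at s)"
      "(y' has_real_derivative \<mu>\<^sup>2 * y s + perp_kernel_norm n s) (at s)" if "s > 0" for s
    using comparison_poisson_mean[OF n \<mu> that] by (simp_all add: y_def y'_def Z_def)
  have iter: "\<bar>v x s\<bar> \<le> W * y s + K * q ^ m * E s" if "s > 0" for x s m
    using that
  proof (induction m arbitrary: x s)
    case 0
    have "W * - y s \<le> W * (2 * MZ * E s)"
      using yE[OF 0] W0 by (intro mult_left_mono) auto
    with vE[OF 0, of x] show ?case by (simp add: K_def algebra_simps)
  next
    case (Suc m)
    define D where "D = K * q ^ Suc m"
    have D: "D * (real n)\<^sup>2 = \<mu>\<^sup>2 * (K * q ^ m)"
      using n by (simp add: D_def q_def power_divide)
    have "0 \<le> W * y s + D * E s + \<epsilon> * v x s" if \<epsilon>: "\<bar>\<epsilon>\<bar> = 1" for \<epsilon>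
    proof (rule nonneg_if_convex_vanishing_at_infinity[OF _ _ _ _ Suc.prems])
      fix t :: real assume t: "t > 0"
      have E': "(E has_real_derivative - real n * E t) (at t)"
        unfolding E_def[abs_def] by (auto intro!: derivative_eq_intros)
      show "((\<lambda>s. W * y s + D * E s + \<epsilon> * v x s) has_real_derivative
          W * y' t + D * (- real n * E t) + \<epsilon> * conj_poisson_mean (\<lambda>y. F1 (x + y)) t) (at t)"
        by (intro DERIV_add DERIV_cmult y v' t E')
      show "((\<lambda>t. W * y' t + D * (- real n * E t) + \<epsilon> * conj_poisson_mean (\<lambda>y. F1 (x + y)) t)
        has_real_derivative W * (\<mu>\<^sup>2 * y t + perp_kernel_norm n t) + D * (- real n * (- real n * E t))
          + \<epsilon> * (- poisson_mean (\<lambda>y. f (x + y)) t)) (at t)"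
        by (intro DERIV_add DERIV_cmult y v'' t E')
      have "\<bar>poisson_mean (\<lambda>y. f (x + y)) t\<bar> \<le>
          W * perp_kernel_norm n t + \<mu>\<^sup>2 * (W * y t + K * q ^ m * E t)"
        by (rule f_bound[OF t Suc.IH[OF t]])
      also have "\<dots> = W * (\<mu>\<^sup>2 * y t + perp_kernel_norm n t) + D * (real n)\<^sup>2 * E t"
        unfolding D by (simp add: algebra_simps)
      finally have "\<bar>\<epsilon> * poisson_mean (\<lambda>y. f (x + y)) t\<bar> \<le>
          W * (\<mu>\<^sup>2 * y t + perp_kernel_norm n t) + D * (real n)\<^sup>2 * E t"
        using \<epsilon> by (simp add: abs_mult)
      then show "0 \<le> W * (\<mu>\<^sup>2 * y t + perp_kernel_norm n t) + D * (- real n * (- real n * E t))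
          + \<epsilon> * (- poisson_mean (\<lambda>y. f (x + y)) t)"
        by (simp add: power2_eq_square abs_le_iff)
    next
      have "(y \<longlongrightarrow> 0) at_top" "(E \<longlongrightarrow> 0) at_top" "(v x \<longlongrightarrow> 0) at_top"
        using exp_decay_tendsto_0[OF n, OF yE[unfolded E_def]]
          exp_decay_tendsto_0[OF n, OF vE[unfolded E_def]]
          exp_decay_tendsto_0[OF n, of E 1] by (auto simp: E_def)
      then have "((\<lambda>s. W * y s + D * E s + \<epsilon> * v x s) \<longlongrightarrow> W * 0 + D * 0 + \<epsilon> * 0) at_top"
        by (intro tendsto_intros)
      then show "((\<lambda>s. W * y s + D * E s + \<epsilon> * v x s) \<longlongrightarrow> 0) at_top"
        by simp
    qed
    from this[of 1] this[of "-1"] show ?case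
      by (simp add: D_def abs_le_iff)
  qed
  have v_le: "\<bar>v x s\<bar> \<le> W * y s" if s: "s > 0" for x s
  proof -
    have "\<bar>q\<bar> < 1"
      using \<mu> n by (simp add: q_def abs_square_less_1)
    then have "(\<lambda>m. W * y s + K * q ^ m * E s) \<longlonglongrightarrow> W * y s + K * 0 * E s"
      by (intro tendsto_intros LIMSEQ_power_zero) auto
    then have "\<bar>v x s\<bar> \<le> W * y s + K * 0 * E s"
      using iter[OF s] by (intro LIMSEQ_le_const) auto
    then show ?thesis by simp
  qed
  have F_le: "\<bar>F x\<bar> \<le> W * Z 0" for x
  proof (rule tendsto_le)
    show "((\<lambda>s. W * y s) \<longlongrightarrow> W * Z 0) (at_right 0)"
      unfolding y_def by (intro tendsto_intros poisson_mean_tendsto periodic_contD(1)[OF Zper])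
    have "(v x \<longlongrightarrow> F (x + 0)) (at_right 0)"
      unfolding v_def by (rule poisson_mean_tendsto) (intro continuous_intros)
    then show "((\<lambda>s. \<bar>v x s\<bar>) \<longlongrightarrow> \<bar>F x\<bar>) (at_right 0)"
      by (intro tendsto_rabs) simp
    show "\<forall>\<^sub>F s in at_right 0. \<bar>v x s\<bar> \<le> W * y s"
      by (rule eventually_mono[OF eventually_at_right_less[of 0]]) (rule v_le)
  qed simp
  have "W * Z 0 \<ge> 0" using F_le[of 0] by linarith
  have "f x = g x - (\<Sum>i\<in>I. c i * F (x + d i))"
    by (simp add: g_def)
  then have "\<bar>f x\<bar> \<le> \<bar>g x\<bar> + \<bar>\<Sum>i\<in>I. c i * F (x + d i)\<bar>"
    by linarith
  also have "\<bar>g x\<bar> \<le> W"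
    using W by (simp add: g_def)
  also have "\<bar>\<Sum>i\<in>I. c i * F (x + d i)\<bar> \<le> (\<Sum>i\<in>I. \<bar>c i\<bar> * (W * Z 0))"
    by (rule order_trans[OF sum_abs], rule sum_mono) (simp add: abs_mult F_le mult_left_mono)
  also have "\<dots> \<le> \<mu>\<^sup>2 * (W * Z 0)"
    unfolding sum_distrib_right[symmetric] by (rule mult_right_mono[OF c \<open>W * Z 0 \<ge> 0\<close>])
  also have "W + \<mu>\<^sup>2 * (W * Z 0) = W / cos (\<mu> * pi / (2 * real n))"
    using \<mu> by (simp add: Z_def comparison_at_0 field_simps)
  finally show ?thesis by simp
qed

theorem theorem4p5:
  fixes k n :: nat and f :: "real \<Rightarrow> real" and \<alpha> :: real
  assumes "k \<ge> 1" and "n \<ge> 1"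
    and "f \<in> trig_perp (n - 1)"
    and "\<alpha> > 1"
  shows "unif_norm f \<le> c_const \<alpha> * gamma_star k * mod_smooth (2 * k) f (\<alpha> * pi / real n)"
proof -
  define h where "h = \<alpha> * pi / real n"
  define \<mu> where "\<mu> = real n / \<alpha>"
  define \<Omega> where "\<Omega> = mod_smooth (2 * k) f h"
  have h: "h > 0" and \<mu>: "0 < \<mu>" "\<mu> < real n" and \<mu>h: "\<mu> = pi / h"
    using assms by (auto simp: h_def \<mu>_def field_simps)
  have fper: "f \<in> periodic_cont"
    using assms(3) by (simp add: trig_perp_iff)
  obtain F F1 where F: "F \<in> trig_perp (n - 1)" "F1 \<in> periodic_cont"
    and deriv: "\<And>x. (F has_real_derivative F1 x) (at x)" "\<And>x. (F1 has_real_derivative f x) (at x)"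
    using trig_perp_second_antiderivative[OF assms(3)] by blast
  define a where "a i = real ((2 * k) choose (k + i)) / real ((2 * k) choose k)" for i
  define b where "b i = (-1) ^ i * a i / (real i)\<^sup>2" for i
  define S where "S = (\<Sum>i=1..k. b i)"
  have a: "0 \<le> a i \<and> a i \<le> 1" for i
    using binomial_maximum'[of k "k + i"] by (simp add: a_def)
  \<comment> \<open>The operator \<open>A\<close> as a combination of the translations by \<open>(i - k) h\<close>, \<open>i \<le> 2k\<close>; the terms
      \<open>-2 F x\<close> of all second differences are collected in the central coefficient.\<close>
  define c where "c i = (if i = k then - (4 / h\<^sup>2 * S)
    else 2 / h\<^sup>2 * b (if i < k then k - i else i - k))" for i
  define d where "d i = (real i - real k) * h" for i
  have bound: "\<bar>f x\<bar> \<le> gamma_star k * \<Omega> / cos (\<mu> * pi / (2 * real n))" for x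
  proof (rule norm_bound_of_perturbed_identity[OF assms(2) \<mu> assms(3) F deriv, of "{..2 * k}"])
    have "(\<Sum>i\<le>2 * k. \<bar>c i\<bar>) = \<bar>c k\<bar> + (\<Sum>i=1..k. \<bar>c (k + i)\<bar> + \<bar>c (k - i)\<bar>)"
      by (rule sum_centered)
    also have "\<dots> = 4 / h\<^sup>2 * \<bar>S\<bar> + (\<Sum>i=1..k. 4 / h\<^sup>2 * (a i / (real i)\<^sup>2))"
    proof (intro arg_cong2[of _ _ _ _ "(+)"] sum.cong refl)
      show "\<bar>c k\<bar> = 4 / h\<^sup>2 * \<bar>S\<bar>"
        by (simp add: c_def abs_mult)
      show "\<bar>c (k + i)\<bar> + \<bar>c (k - i)\<bar> = 4 / h\<^sup>2 * (a i / (real i)\<^sup>2)" if "i \<in> {1..k}" for i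
        using that a[of i] by (auto simp: c_def b_def abs_mult power_abs)
    qed
    also have "\<dots> = 4 / h\<^sup>2 * ((\<Sum>i=1..k. a i / (real i)\<^sup>2) + \<bar>S\<bar>)"
      unfolding sum_distrib_left[symmetric] by (simp only: distrib_left add.commute)
    also have "\<dots> \<le> 4 / h\<^sup>2 * (pi\<^sup>2 / 4)"
      unfolding S_def b_def by (intro mult_left_mono alternating_inverse_squares_bound a) auto
    finally show "(\<Sum>i\<le>2 * k. \<bar>c i\<bar>) \<le> \<mu>\<^sup>2"
      by (simp add: \<mu>h power_divide)
  next
    fix x
    have "(\<Sum>i\<le>2 * k. c i * F (x + d i)) =
        c k * F (x + d k) + (\<Sum>i=1..k. c (k + i) * F (x + d (k + i)) + c (k - i) * F (x + d (k - i)))"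
      by (rule sum_centered)
    also have "c k * F (x + d k) = (\<Sum>i=1..k. 2 / h\<^sup>2 * (b i * (- 2 * F x)))"
      unfolding sum_distrib_left[symmetric] sum_distrib_right[symmetric] S_def[symmetric]
      by (simp add: c_def d_def)
    also have "(\<Sum>i=1..k. c (k + i) * F (x + d (k + i)) + c (k - i) * F (x + d (k - i))) =
        (\<Sum>i=1..k. 2 / h\<^sup>2 * (b i * (F (x + real i * h) + F (x - real i * h))))"
    proof (rule sum.cong[OF refl])
      fix i assume i: "i \<in> {1..k}"
      then have "d (k + i) = real i * h" "d (k - i) = - (real i * h)"
        by (auto simp: d_def of_nat_diff)
      moreover have "c (k + i) = 2 / h\<^sup>2 * b i" "c (k - i) = 2 / h\<^sup>2 * b i"
        using i by (auto simp: c_def)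
      ultimately show "c (k + i) * F (x + d (k + i)) + c (k - i) * F (x + d (k - i)) =
          2 / h\<^sup>2 * (b i * (F (x + real i * h) + F (x - real i * h)))"
        by (simp add: distrib_left mult.assoc)
    qed
    finally have "(\<Sum>i\<le>2 * k. c i * F (x + d i)) = 2 / h\<^sup>2 * (\<Sum>i=1..k.
        b i * (F (x + real i * h) + F (x - real i * h) - 2 * F x))"
      unfolding sum_distrib_left sum.distrib[symmetric] distrib_left[symmetric] by simp
    moreover have "\<bar>f x + 2 / h\<^sup>2 * (\<Sum>i=1..k. b i *
        (F (x + real i * h) + F (x - real i * h) - 2 * F x))\<bar> \<le> gamma_star k * \<Omega>"
      unfolding b_def a_def \<Omega>_def
      by (rule hat_average_centered_difference[OF deriv h assms(1)
          abs_fin_diff_le_mod_smooth[OF fper]])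
    ultimately show "\<bar>f x + (\<Sum>i\<le>2 * k. c i * F (x + d i))\<bar> \<le> gamma_star k * \<Omega>"
      by simp
  qed simp
  have angle: "\<mu> * pi / (2 * real n) = pi / (2 * \<alpha>)"
    using assms by (simp add: \<mu>_def)
  have "gamma_star k * \<Omega> / cos (\<mu> * pi / (2 * real n)) =
      c_const \<alpha> * gamma_star k * mod_smooth (2 * k) f (\<alpha> * pi / real n)"
    unfolding angle c_const_def \<Omega>_def h_def divide_inverse[of "gamma_star k * _"]
    by (simp only: mult_ac)
  with bound show ?thesis
    unfolding unif_norm_def by (intro cSUP_least) auto
qed

end
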